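(* Let $\alpha,\gamma\in(0,1)$ and let $f,D,g$ satisfy: $f\in C^1[0,1]$ with $f(0)=0$; $D\in C^1[0,1]$ with $D>0$ on $(0,\alpha)$ and $D<0$ on $(\alpha,1)$; $g\in C^0[0,1]$ with $g<0$ on $(0,\gamma)$, $g>0$ on $(\gamma,1)$ and $g(0)=g(\gamma)=g(1)=0$. Assume $f$ is strictly concave. Write $q=Dg$ and $\delta(q,\phi_0)(\phi)=\frac{q(\phi)-q(\phi_0)}{\phi-\phi_0}$. Then the equation $\rho_t+f(\rho)_x=(D(\rho)\rho_x)_x+g(\rho)$ admits wavefronts in each of the following cases: (a) $\alpha>\gamma$, $\dot g(\gamma)$ exists and is positive, and $$\dot f(\gamma)-\frac{f(1)-f(\alpha)}{1-\alpha}\ge 2\left(\sqrt{\sup_{[\alpha,1)}\delta(q,1)}+\sqrt{\sup_{[0,\gamma)}\delta(q,\gamma)}\right);\qquad(\ast)$$ (b) $\alpha=\gamma$, $(\ast)$ holds, and there are $L>0$, $\tau\in(0,1)$ with $|g(\phi)|\ge L|\phi-\gamma|^\tau$ in a full neighborhood of $\gamma$; (c) $\alpha<\gamma$ and $$\dot f(\gamma)-\frac{f(1)-f(\gamma)}{1-\gamma}>2\left(\sqrt{\sup_{[\gamma,1)}\delta(q,1)}+\sqrt{\sup_{[0,\gamma]\setminus\{\alpha\}}\delta(q,\alpha)}\right).$$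
   Context: A traveling wave with speed $c$ and profile $\phi$ is a function $\phi\in C(\mathbb R)$ with values in $[0,1]$, differentiable a.e., with $D(\phi)\phi'\in L^1_{\rm loc}$, such that $\int_{\mathbb R}\big(D(\phi)\phi'-f(\phi)+c\phi\big)\psi'-g(\phi)\psi\,d\xi=0$ for all $\psi\in C_0^\infty(\mathbb R)$; a wavefront is such a traveling wave with monotone non-constant profile; here profiles are taken non-increasing with $\phi(-\infty)=1$, $\phi(+\infty)=0$. *)

theory Defs
  imports "HOL-Analysis.Analysis"
begin

definition test_fun :: "(real \<Rightarrow> real) \<Rightarrow> bool" where
  "test_fun \<psi> \<longleftrightarrow> (\<forall>n x. ((deriv ^^ n) \<psi>) differentiable (at x))
                    \<and> bounded {x. \<psi> x \<noteq> 0}"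

text \<open>Weak traveling wave of rho_t + f(rho)_x = (D(rho) rho_x)_x + g(rho) with speed c and
  profile phi; phi' is an a.e. derivative of phi.\<close>
definition traveling_wave ::
  "(real \<Rightarrow> real) \<Rightarrow> (real \<Rightarrow> real) \<Rightarrow> (real \<Rightarrow> real) \<Rightarrow> real \<Rightarrow> (real \<Rightarrow> real) \<Rightarrow> bool" where
  "traveling_wave f D g c \<phi> \<longleftrightarrow>
     continuous_on UNIV \<phi> \<and> (\<forall>\<xi>. \<phi> \<xi> \<in> {0..1}) \<and>
     (\<exists>\<phi>'. (AE \<xi> in lborel. (\<phi> has_real_derivative \<phi>' \<xi>) (at \<xi>)) \<and>
       (\<forall>a b. set_integrable lborel {a..b} (\<lambda>\<xi>. D (\<phi> \<xi>) * \<phi>' \<xi>)) \<and>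
       (\<forall>\<psi>. test_fun \<psi> \<longrightarrow>
          (LINT \<xi>|lborel. (D (\<phi> \<xi>) * \<phi>' \<xi> - f (\<phi> \<xi>) + c * \<phi> \<xi>) * deriv \<psi> \<xi>
                          - g (\<phi> \<xi>) * \<psi> \<xi>) = 0))"

definition wavefront ::
  "(real \<Rightarrow> real) \<Rightarrow> (real \<Rightarrow> real) \<Rightarrow> (real \<Rightarrow> real) \<Rightarrow> real \<Rightarrow> (real \<Rightarrow> real) \<Rightarrow> bool" where
  "wavefront f D g c \<phi> \<longleftrightarrow> traveling_wave f D g c \<phi> \<and> antimono \<phi> \<and>
     (\<exists>x y. \<phi> x \<noteq> \<phi> y) \<and> (\<phi> \<longlongrightarrow> 1) at_bot \<and> (\<phi> \<longlongrightarrow> 0) at_top"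

definition C1_on_01 :: "(real \<Rightarrow> real) \<Rightarrow> (real \<Rightarrow> real) \<Rightarrow> bool" where
  "C1_on_01 h h' \<longleftrightarrow> (\<forall>x\<in>{0..1}. (h has_real_derivative h' x) (at x within {0..1}))
                       \<and> continuous_on {0..1} h'"

definition strictly_concave_on :: "real set \<Rightarrow> (real \<Rightarrow> real) \<Rightarrow> bool" where
  "strictly_concave_on S h \<longleftrightarrow> (\<forall>x\<in>S. \<forall>y\<in>S. \<forall>t. x \<noteq> y \<and> 0 < t \<and> t < 1 \<longrightarrow>
       h ((1 - t) * x + t * y) > (1 - t) * h x + t * h y)"

definition dq :: "(real \<Rightarrow> real) \<Rightarrow> real \<Rightarrow> real \<Rightarrow> real" where
  "dq q \<phi>0 \<phi> = (q \<phi> - q \<phi>0) / (\<phi> - \<phi>0)"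

end

theory Submission
  imports Defs
begin

text \<open>
  Seeking the flux \<open>D(\<phi>) \<phi>'\<close> as a function \<open>z(\<phi>)\<close> turns the profile equation into the singular first
  order problem \<open>z' = f' - c - D g / z\<close> with \<open>z(0) = z(\<alpha>) = z(1) = 0\<close> and \<open>D z < 0\<close> elsewhere; the profile
  is then recovered by inverting \<open>\<xi> = \<integral> D / z\<close>, which has to converge at \<open>\<alpha>\<close>.
  On each interval where \<open>D g\<close> has a constant sign, \<open>\<bar>z\<bar>\<close> solves, in a suitable direction, an equation
  \<open>y' = A + P / y\<close> with \<open>P > 0\<close>. This always has a positive solution, even from \<open>y = 0\<close>, and positive
  solutions stay below supersolutions. Concavity of \<open>f\<close> makes
  \<open>f(x) - f(p) - c (x - p) - \<surd>S \<bar>x - p\<bar>\<close>, where \<open>S\<close> is the supremum of the difference quotient of \<open>D g\<close>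
  at \<open>p\<close>, up to sign a supersolution that vanishes at \<open>p\<close>; this produces the boundary values.
  If \<open>\<alpha> = \<gamma>\<close> or \<open>\<alpha> < \<gamma>\<close>, any speed between the two resulting thresholds works. If \<open>\<gamma> < \<alpha>\<close>, the speed
  is determined on \<open>[0, \<alpha>]\<close> by matching at \<open>\<gamma>\<close>, and the hypothesis makes it large enough for \<open>[\<alpha>, 1]\<close>.
\<close>

section \<open>The singular equation \<open>y' = A + P / y\<close>\<close>

text \<open>The sign of \<open>q = D g\<close> fixes the direction of integration: where
  \<open>q < 0\<close>, \<bar>z\<bar> solves the singular equation for increasing argument, where
  \<open>q > 0\<close> for decreasing argument. In that direction the source \<open>P / y\<close>
  repels solutions from 0, so leaving 0 costs nothing and every condition on the speed comes from
  having to arrive at 0. For \<alpha> = \<gamma> the arrivals are at \<alpha> and at 1. For \<alpha>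
  < \<gamma> they are at \<alpha> from both sides and at 1, with a free common starting value at
  \<gamma>. For \<gamma> < \<alpha> two solutions run towards each other and meet at \<gamma>, and
  only 1 is an arrival. The number \<open>2 * sqrt S\<close> is the minimum of
  \<open>k + S / k\<close>: near an arrival point p a barrier \<open>k * \<bar>x - p\<bar>\<close>
  has to absorb the source \<open>S / k\<close> besides its own slope, and \<open>k = sqrt S\<close>
  is the cheapest choice. The second obstacle is that \<open>D / z\<close> has the form 0/0 at
  \<alpha>. The equation itself gives \<open>D / z = (f' - c - z') / g\<close>, so integrability
  there is a matter of integrating \<open>z'\<close> against \<open>1 / g\<close>; this is easy if g
  does not vanish at \<alpha> and needs the lower bound with exponent \<tau> < 1 if it does.\<close>

text \<open>After the last point where u \<le> v, the difference u - v is nonincreasing. The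
  derivatives are compared only where u exceeds v, which is exactly where the monotone dependence of
  \<open>P / y\<close> on y helps; this replaces a Lipschitz condition, which fails at y =
  0.\<close>

lemma comparison_le:
  fixes u v :: "real \<Rightarrow> real"
  assumes u: "continuous_on {a..b} u" and v: "continuous_on {a..b} v" and init: "u a \<le> v a"
    and der: "\<And>t. a < t \<Longrightarrow> t < b \<Longrightarrow> v t < u t \<Longrightarrow>
      \<exists>du dv. (u has_real_derivative du) (at t) \<and> (v has_real_derivative dv) (at t) \<and> du \<le> dv"
    and x: "x \<in> {a..b}"
  shows "u x \<le> v x"
proof (rule ccontr)
  assume neg: "\<not> u x \<le> v x"
  define w where "w t = u t - v t" for t
  have cw: "continuous_on {a..x} w"
    unfolding w_def using x
    by (intro continuous_intros continuous_on_subset[OF u] continuous_on_subset[OF v]) auto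
  define S where "S = {a..x} \<inter> w -` {..0}"
  have "closed S"
    unfolding S_def by (rule continuous_closed_preimage[OF cw]) auto
  moreover have "a \<in> S" using init x by (auto simp: S_def w_def)
  moreover have bdd: "bdd_above S" by (rule bdd_aboveI[of _ x]) (auto simp: S_def)
  ultimately have S: "Sup S \<in> S" by (intro closed_contains_Sup) auto
  define t0 where "t0 = Sup S"
  have t0: "a \<le> t0" "t0 \<le> x" "w t0 \<le> 0" using S by (auto simp: S_def t0_def)
  have pos: "0 < w t" if "t0 < t" "t \<le> x" for t
  proof (rule ccontr)
    assume "\<not> 0 < w t"
    then have "t \<in> S" using that t0 by (auto simp: S_def)
    then have "t \<le> t0" unfolding t0_def by (rule cSup_upper[OF _ bdd])
    then show False using that by simp
  qed
  have "w x \<le> w t0"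
  proof (rule DERIV_nonpos_imp_decreasing_open[of t0 x w])
    fix t assume t: "t0 < t" "t < x"
    then have "v t < u t" using pos[of t] by (simp add: w_def)
    from der[OF _ _ this] t t0 x obtain du dv
      where d: "(u has_real_derivative du) (at t)" "(v has_real_derivative dv) (at t)" "du \<le> dv"
      by auto
    then show "\<exists>y. (w has_real_derivative y) (at t) \<and> y \<le> 0"
      unfolding w_def[abs_def] by (intro exI[of _ "du - dv"]) (auto intro!: derivative_eq_intros)
  qed (use t0 in \<open>auto intro: continuous_on_subset[OF cw]\<close>)
  then show False using t0 neg by (simp add: w_def)
qed

text \<open>Picard iteration on the whole interval at once. Writing the unknown as
  \<open>E * v\<close> with the exponential weight E makes the integral operator a contraction with
  factor 1/2, however large K and the interval are.\<close>

lemma lipschitz_ivp: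
  fixes F :: "real \<Rightarrow> real \<Rightarrow> real"
  assumes ab: "a < b" and K: "0 < K"
    and cF: "\<And>u. continuous_on {a..b} u \<Longrightarrow> continuous_on {a..b} (\<lambda>s. F s (u s))"
    and lip: "\<And>s y z. s \<in> {a..b} \<Longrightarrow> \<bar>F s y - F s z\<bar> \<le> K * \<bar>y - z\<bar>"
  shows "\<exists>y. continuous_on {a..b} y \<and> y a = \<eta> \<and>
           (\<forall>t\<in>{a<..<b}. (y has_real_derivative F t (y t)) (at t))"
proof -
  \<comment> \<open>The fixed point is sought among bounded continuous functions on the whole line;
    clamping the argument extends functions on the interval by constants.\<close>
  define cl where "cl t = max a (min b t)" for t
  have cl: "cl t \<in> {a..b}" for t using ab by (auto simp: cl_def)
  have cl_id: "t \<in> {a..b} \<Longrightarrow> cl t = t" for t by (auto simp: cl_def)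
  have ccl: "continuous_on UNIV cl" unfolding cl_def by (intro continuous_intros)
  define E where "E s = exp (2 * K * (s - a))" for s
  have E0: "0 < E s" for s by (simp add: E_def)
  have cE: "continuous_on S E" for S unfolding E_def by (intro continuous_intros)
  define J where "J v t = integral {a..t} (\<lambda>s. F s (E s * v s))" for v t
  have cG: "continuous_on {a..b} (\<lambda>s. F s (E s * apply_bcontfun v s))" for v
    by (intro cF continuous_on_mult cE continuous_on_apply_bcontfun)
  have cJ: "continuous_on {a..b} (J (apply_bcontfun v))" for v
    unfolding J_def by (intro indefinite_integral_continuous_1 integrable_continuous_real cG)
  define R where "R v t = (\<eta> + J v (cl t)) / E (cl t)" for v t
  have R: "R (apply_bcontfun v) \<in> bcontfun" for v
  proof -
    have c: "continuous_on {a..b} (\<lambda>t. (\<eta> + J (apply_bcontfun v) t) / E t)"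
      using E0 by (intro continuous_intros cJ cE) (auto simp: less_imp_neq[symmetric])
    have "bounded ((\<lambda>t. (\<eta> + J (apply_bcontfun v) t) / E t) ` {a..b})"
      by (intro compact_imp_bounded compact_continuous_image[OF c]) auto
    then obtain B where B: "\<And>t. t \<in> {a..b} \<Longrightarrow> norm ((\<eta> + J (apply_bcontfun v) t) / E t) \<le> B"
      unfolding bounded_iff by blast
    have "continuous_on UNIV (\<lambda>t. (\<lambda>t. (\<eta> + J (apply_bcontfun v) t) / E t) (cl t))"
      by (rule continuous_on_compose2[OF c ccl]) (use cl in auto)
    then show ?thesis
      by (intro bcontfun_normI[where b = B]) (use B[OF cl] in \<open>auto simp: R_def[abs_def]\<close>)
  qed
  define T where "T v = Bcontfun (R (apply_bcontfun v))" for v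
  have T: "apply_bcontfun (T v) = R (apply_bcontfun v)" for v
    unfolding T_def by (rule Bcontfun_inverse[OF R])
  have "\<exists>!v. T v = v"
  proof (rule banach_fix_type[of "1/2"])
    show "\<forall>v w. dist (T v) (T w) \<le> 1/2 * dist v w"
    proof (intro allI)
      fix v w :: "real \<Rightarrow>\<^sub>C real"
      let ?v = "apply_bcontfun v" and ?w = "apply_bcontfun w"
      define d where "d = dist v w"
      have pw: "\<bar>?v s - ?w s\<bar> \<le> d" for s
        using dist_bounded[of v s w] by (simp add: d_def dist_real_def)
      show "dist (T v) (T w) \<le> 1/2 * dist v w"
      proof (rule dist_bound)
        fix t
        define t' where "t' = cl t"
        have t': "a \<le> t'" "t' \<le> b" using cl[of t] by (auto simp: t'_def)
        have i: "(\<lambda>s. F s (E s * apply_bcontfun u s)) integrable_on {a..t'}" for u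
          by (rule integrable_continuous_real[OF continuous_on_subset[OF cG]]) (use t' in auto)
        \<comment> \<open>Since \<open>E' = 2 * K * E\<close>, integrating the Lipschitz bound gains
          the factor 1/2, and dividing by \<open>E t'\<close> afterwards removes the weight.\<close>
        have hi: "((\<lambda>s. K * d * E s) has_integral (d / 2 * E t' - d / 2 * E a)) {a..t'}"
          by (rule fundamental_theorem_of_calculus)
            (use t' in \<open>auto simp: E_def has_real_derivative_iff_has_vector_derivative[symmetric]
               intro!: derivative_eq_intros\<close>)
        have "\<bar>J ?v t' - J ?w t'\<bar> = norm (integral {a..t'} (\<lambda>s. F s (E s * ?v s) - F s (E s * ?w s)))"
          unfolding J_def by (simp add: integral_diff[OF i i])
        also have "\<dots> \<le> integral {a..t'} (\<lambda>s. K * d * E s)"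
        proof (rule integral_norm_bound_integral)
          show "(\<lambda>s. F s (E s * ?v s) - F s (E s * ?w s)) integrable_on {a..t'}"
            by (intro integrable_diff i)
          show "(\<lambda>s. K * d * E s) integrable_on {a..t'}" using hi by blast
          fix s assume s: "s \<in> {a..t'}"
          have "\<bar>F s (E s * ?v s) - F s (E s * ?w s)\<bar> \<le> K * \<bar>E s * ?v s - E s * ?w s\<bar>"
            by (rule lip) (use s t' in auto)
          also have "\<dots> = K * (E s * \<bar>?v s - ?w s\<bar>)"
            using E0[of s] by (simp add: right_diff_distrib[symmetric] abs_mult)
          also have "\<dots> \<le> K * (E s * d)"
            using E0[of s] K pw[of s] by (intro mult_left_mono) auto
          finally show "norm (F s (E s * ?v s) - F s (E s * ?w s)) \<le> K * d * E s"
            by (simp add: algebra_simps)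
        qed
        also have "\<dots> = d / 2 * E t' - d / 2 * E a" using hi by (rule integral_unique)
        also have "\<dots> \<le> d / 2 * E t'" using E0[of a] by (simp add: d_def)
        finally have J: "\<bar>J ?v t' - J ?w t'\<bar> \<le> d / 2 * E t'" .
        have "\<bar>R ?v t - R ?w t\<bar> = \<bar>J ?v t' - J ?w t'\<bar> / E t'"
          using E0[of t'] by (simp add: R_def t'_def[symmetric] diff_divide_distrib[symmetric])
        also have "\<dots> \<le> d / 2" using J E0[of t'] by (simp add: divide_le_eq)
        finally show "dist (apply_bcontfun (T v) t) (apply_bcontfun (T w) t) \<le> 1/2 * dist v w"
          by (simp add: T dist_real_def d_def)
      qed
    qed
  qed auto
  then obtain v where v: "T v = v" by auto
  define y where "y t = E t * apply_bcontfun v t" for t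
  have y: "y t = \<eta> + integral {a..t} (\<lambda>s. F s (y s))" if "t \<in> {a..b}" for t
  proof -
    have "apply_bcontfun v t = R (apply_bcontfun v) t" using T[of v] v by simp
    then show ?thesis
      using E0[of t] that by (simp add: y_def R_def cl_id J_def)
  qed
  have cy: "continuous_on {a..b} y" unfolding y_def[abs_def] by (intro continuous_on_mult cE continuous_on_apply_bcontfun)
  have cFy: "continuous_on {a..b} (\<lambda>s. F s (y s))" by (rule cF[OF cy])
  have "(y has_real_derivative F t (y t)) (at t)" if t: "t \<in> {a<..<b}" for t
  proof -
    have "((\<lambda>t. \<eta> + integral {a..t} (\<lambda>s. F s (y s))) has_real_derivative F t (y t)) (at t within {a..b})"
      using DERIV_add[OF DERIV_const integral_has_real_derivative[OF cFy, of t], of \<eta>] t by simp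
    then have "(y has_real_derivative F t (y t)) (at t within {a..b})"
      by (rule has_field_derivative_transform_within[where d = 1]) (use t y in auto)
    then show ?thesis using t by (simp add: at_within_Icc_at)
  qed
  then show ?thesis using cy y[of a] ab by auto
qed

section \<open>Positive solutions and their existence from nonnegative data\<close>

text \<open>The equation is imposed only inside the interval and the end values enter through
  continuity, so y may vanish at a or b, where the right-hand side is singular.\<close>

definition positive_sol :: "(real \<Rightarrow> real) \<Rightarrow> (real \<Rightarrow> real) \<Rightarrow> real \<Rightarrow> real \<Rightarrow> (real \<Rightarrow> real) \<Rightarrow> bool" where
  "positive_sol A P a b y \<longleftrightarrow> continuous_on {a..b} y \<and>
     (\<forall>t\<in>{a<..<b}. 0 < y t \<and> (y has_real_derivative A t + P t / y t) (at t))"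

lemma positive_sol_le_supersolution:
  assumes y: "positive_sol A P a b y" and P: "\<And>t. t \<in> {a<..<b} \<Longrightarrow> 0 \<le> P t"
    and Z: "continuous_on {a..b} Z" "y a \<le> Z a"
    and dZ: "\<And>t. t \<in> {a<..<b} \<Longrightarrow> 0 < Z t \<and>
      (\<exists>d. (Z has_real_derivative d) (at t) \<and> A t + P t / Z t \<le> d)"
    and x: "x \<in> {a..b}"
  shows "y x \<le> Z x"
proof (rule comparison_le[where a = a and b = b and
      u = y and v = Z])
  fix t assume t: "a < t" "t < b" "Z t < y t"
  then obtain d where d: "(Z has_real_derivative d) (at t)" "A t + P t / Z t \<le> d" "0 < Z t"
    using dZ[of t] by auto
  moreover have "P t / y t \<le> P t / Z t"
    using t d P[of t] by (intro divide_left_mono) auto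
  moreover have "(y has_real_derivative A t + P t / y t) (at t)"
    using y t by (auto simp: positive_sol_def)
  ultimately show "\<exists>du dv. (y has_real_derivative du) (at t) \<and> (Z has_real_derivative dv) (at t) \<and> du \<le> dv"
    by (intro exI[of _ "A t + P t / y t"] exI[of _ d]) auto
qed (use assms in \<open>auto simp: positive_sol_def\<close>)

lemma positive_sol_end_nonneg:
  assumes y: "positive_sol A P a b y" and ab: "a < b"
  shows "0 \<le> y b"
proof -
  have lim: "(y \<longlongrightarrow> y b) (at b within {a<..<b})"
    by (rule tendsto_within_subset[of _ _ _ "{a..b}"])
      (use y ab in \<open>auto simp: positive_sol_def continuous_on_def\<close>)
  have nb: "at b within {a<..<b} \<noteq> bot"
    using ab by (simp add: at_within_eq_bot_iff closure_greaterThanLessThan)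
  show ?thesis
    by (rule tendsto_lowerbound[OF lim _ nb])
      (use y in \<open>auto simp: positive_sol_def eventually_at_filter less_imp_le\<close>)
qed

text \<open>Flooring the denominator at \<open>e n\<close> gives Lipschitz problems. Their solutions
  increase with n, and bounds uniform in n carry the integrated equation to the limit, also for
  \<eta> = 0.\<close>

lemma positive_sol_exists:
  fixes A P :: "real \<Rightarrow> real"
  assumes ab: "a < b" and A: "continuous_on {a..b} A" and P: "continuous_on {a..b} P"
    and P0: "\<And>t. t \<in> {a..b} \<Longrightarrow> 0 \<le> P t" and Ppos: "\<And>t. t \<in> {a<..<b} \<Longrightarrow> 0 < P t"
    and \<eta>: "0 \<le> \<eta>"
  shows "\<exists>y. positive_sol A P a b y \<and> y a = \<eta>"
proof -
  obtain B1 where B1: "\<And>t. t \<in> {a..b} \<Longrightarrow> norm (A t) \<le> B1"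
    using compact_imp_bounded[OF compact_continuous_image[OF A]] unfolding bounded_iff by blast
  obtain B2 where B2: "\<And>t. t \<in> {a..b} \<Longrightarrow> norm (P t) \<le> B2"
    using compact_imp_bounded[OF compact_continuous_image[OF P]] unfolding bounded_iff by blast
  define M where "M = max 1 (max B1 B2)"
  have M0: "0 < M" by (simp add: M_def)
  have M: "- M \<le> A t" "A t \<le> M" "P t \<le> M" if "t \<in> {a..b}" for t
    using B1[OF that] B2[OF that] by (auto simp: M_def)
  define e where "e n = inverse (real (Suc n))" for n
  have e0: "0 < e n" for n by (simp add: e_def)
  have eSuc: "e (Suc n) \<le> e n" for n by (simp add: e_def field_simps)
  have elim: "e \<longlonglongrightarrow> 0" unfolding e_def[abs_def] by (rule LIMSEQ_inverse_real_of_nat)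
  define F where "F n t y = A t + P t / max y (e n)" for n t y
  have "\<exists>y. continuous_on {a..b} y \<and> y a = \<eta> \<and>
           (\<forall>t\<in>{a<..<b}. (y has_real_derivative F n t (y t)) (at t))" for n
  proof (rule lipschitz_ivp[OF ab, of "M / (e n)\<^sup>2"])
    show "0 < M / (e n)\<^sup>2" using M0 e0[of n] by simp
    fix u :: "real \<Rightarrow> real" assume "continuous_on {a..b} u"
    then show "continuous_on {a..b} (\<lambda>s. F n s (u s))"
      unfolding F_def using e0[of n]
      by (intro continuous_intros A P) (auto simp: max_def less_imp_neq[symmetric])
  next
    fix s y z assume s: "s \<in> {a..b}"
    let ?y = "max y (e n)" and ?z = "max z (e n)"
    have yz: "e n \<le> ?y" "e n \<le> ?z" by auto
    have "F n s y - F n s z = P s * (?z - ?y) / (?y * ?z)"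
      unfolding F_def using yz e0[of n] by (simp add: field_simps)
    then have "\<bar>F n s y - F n s z\<bar> = P s * \<bar>?z - ?y\<bar> / (?y * ?z)"
      using yz e0[of n] P0[OF s] by (simp add: abs_mult)
    also have "\<dots> \<le> M * \<bar>y - z\<bar> / (e n * e n)"
      using yz e0[of n] M[OF s] P0[OF s] M0
      by (intro frac_le mult_mono) (auto simp: abs_if max_def)
    finally show "\<bar>F n s y - F n s z\<bar> \<le> M / (e n)\<^sup>2 * \<bar>y - z\<bar>"
      by (simp add: power2_eq_square)
  qed
  then obtain Y where cY: "\<And>n. continuous_on {a..b} (Y n)" and Ya: "\<And>n. Y n a = \<eta>"
    and dY: "\<And>n t. t \<in> {a<..<b} \<Longrightarrow> (Y n has_real_derivative F n t (Y n t)) (at t)"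
    by metis
  have csub: "continuous_on {x..x'} (Y n)" if "a \<le> x" "x' \<le> b" for x x' n
    by (rule continuous_on_subset[OF cY]) (use that in auto)
  \<comment> \<open>Lowering the floor can only enlarge the source term.\<close>
  have mono: "Y n x \<le> Y (Suc n) x" if "x \<in> {a..b}" for n x
  proof (rule comparison_le[where a = a and b = b and
      u = "Y n" and v = "Y (Suc n)"])
    fix t assume t: "a < t" "t < b" "Y (Suc n) t < Y n t"
    have "P t / max (Y n t) (e n) \<le> P t / max (Y (Suc n) t) (e (Suc n))"
      using t e0[of "Suc n"] e0[of n] eSuc[of n] P0[of t] by (intro divide_left_mono) auto
    then have "F n t (Y n t) \<le> F (Suc n) t (Y (Suc n) t)" by (simp add: F_def)
    then show "\<exists>du dv. (Y n has_real_derivative du) (at t) \<and>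
        (Y (Suc n) has_real_derivative dv) (at t) \<and> du \<le> dv"
      using dY[of t] t by (intro exI[of _ "F n t (Y n t)"] exI[of _ "F (Suc n) t (Y (Suc n) t)"]) auto
  qed (use that cY Ya in auto)
  \<comment> \<open>Above height k the source is at most \<open>M / k\<close>, so a line of slope
    \<open>M + M / k\<close> starting k above the data is a barrier independent of n. The free
    parameter k later provides continuity even where the limit vanishes.\<close>
  have upper: "Y n x' \<le> max (Y n x) 0 + k + (M + M / k) * (x' - x)"
    if x: "a \<le> x" "x \<le> x'" "x' \<le> b" and k: "0 < k" for n x x' k
  proof (rule comparison_le[where a = x and b = x' and
      u = "Y n" and v = "\<lambda>t. max (Y n x) 0 + k + (M + M / k) * (t - x)"])
    fix t assume t: "x < t" "t < x'" "max (Y n x) 0 + k + (M + M / k) * (t - x) < Y n t"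
    have "0 \<le> (M + M / k) * (t - x)" using t k M0 by (intro mult_nonneg_nonneg add_nonneg_nonneg) auto
    then have "k \<le> max (Y n t) (e n)" using t by linarith
    then have "P t / max (Y n t) (e n) \<le> M / k"
      using M[of t] P0[of t] k M0 t x by (intro frac_le) auto
    then have "F n t (Y n t) \<le> M + M / k" using M[of t] t x by (simp add: F_def)
    moreover have "((\<lambda>t. max (Y n x) 0 + k + (M + M / k) * (t - x)) has_real_derivative M + M / k) (at t)"
      by (auto intro!: derivative_eq_intros)
    ultimately show "\<exists>du dv. (Y n has_real_derivative du) (at t) \<and>
       ((\<lambda>t. max (Y n x) 0 + k + (M + M / k) * (t - x)) has_real_derivative dv) (at t) \<and> du \<le> dv"
      using dY[of t n] t x by (intro exI[of _ "F n t (Y n t)"] exI[of _ "M + M / k"]) auto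
  qed (use x k in \<open>auto intro!: continuous_intros csub\<close>)
  have lower: "Y n x - M * (x' - x) \<le> Y n x'"
    if x: "a \<le> x" "x \<le> x'" "x' \<le> b" for n x x'
  proof (rule comparison_le[where a = x and b = x' and
      u = "\<lambda>t. Y n x - M * (t - x)" and v = "Y n"])
    fix t assume t: "x < t" "t < x'"
    have "0 \<le> P t / max (Y n t) (e n)"
      using P0[of t] t x e0[of n] by (intro divide_nonneg_nonneg) auto
    then have "- M \<le> F n t (Y n t)" using M[of t] t x by (simp add: F_def)
    moreover have "((\<lambda>t. Y n x - M * (t - x)) has_real_derivative - M) (at t)"
      by (auto intro!: derivative_eq_intros)
    ultimately show "\<exists>du dv. ((\<lambda>t. Y n x - M * (t - x)) has_real_derivative du) (at t) \<and>
       (Y n has_real_derivative dv) (at t) \<and> du \<le> dv"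
      using dY[of t n] t x by (intro exI[of _ "F n t (Y n t)"] exI[of _ "- M"]) auto
  qed (use x in \<open>auto intro!: continuous_intros csub\<close>)
  have pos: "\<exists>k>0. \<forall>n. e n \<le> k \<longrightarrow> (\<forall>x\<in>{x0..x1}. k \<le> Y n x)"
    if x01: "a < x0" "x0 < x1" "x1 < b" for x0 x1
  proof -
    define r where "r = (x0 - a) / 2"
    have r0: "0 < r" using x01 by (simp add: r_def)
    have "\<exists>u\<in>{a + r..x1}. \<forall>t\<in>{a + r..x1}. P u \<le> P t"
      by (rule continuous_attains_inf)
        (use x01 in \<open>auto simp: r_def field_simps intro: continuous_on_subset[OF P]\<close>)
    then obtain u where u: "u \<in> {a + r..x1}" "\<And>t. t \<in> {a + r..x1} \<Longrightarrow> P u \<le> P t" by blast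
    define m where "m = P u"
    have m0: "0 < m" unfolding m_def by (rule Ppos) (use u x01 r0 in auto)
    \<comment> \<open>Below height k the source is at least \<open>m / k\<close>. The choice of k
      makes this exceed \<open>2 * M + 1 / r\<close>, enough to overcome A and still push a solution
      up to k within the available distance.\<close>
    define k where "k = min 1 (m / (2 * M + 1 / r))"
    have Q: "0 < 2 * M + 1 / r" using M0 r0 by (simp add: add_pos_pos)
    have "0 < k" "k \<le> 1" using m0 Q by (auto simp: k_def)
    moreover have "k \<le> m / (2 * M + 1 / r)" by (simp add: k_def)
    ultimately have k: "0 < k" "k \<le> 1" "k * (2 * M + 1 / r) \<le> m"
      using Q by (simp_all add: pos_le_divide_eq)
    then have k': "2 * M + 1 / r \<le> m / k" by (simp add: pos_le_divide_eq mult.commute)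
    have "k \<le> Y n x" if n: "e n \<le> k" and x: "x \<in> {x0..x1}" for n x
    proof -
      define s where "s = (a + x) / 2"
      have s: "a + r \<le> s" "s < x" "r \<le> x - s" "s - a = x - s"
        using x x01 by (auto simp: s_def r_def field_simps)
      \<comment> \<open>The slope of the line that equals k at x and \<open>- M * (s - a)\<close> at
        s. The latter is the worst value allowed by \<open>lower\<close>, because s is the midpoint
        of a and x.\<close>
      define \<sigma> where "\<sigma> = k / (x - s) + M"
      have "k / (x - s) \<le> 1 / r" using k s r0 by (intro frac_le) auto
      then have \<sigma>: "\<sigma> \<le> - M + m / k" using k' by (simp add: \<sigma>_def)
      have \<sigma>0: "0 < \<sigma>" using k s M0 by (simp add: \<sigma>_def add_pos_pos)
      have \<sigma>1: "\<sigma> * (x - s) = k + M * (x - s)" using s by (simp add: \<sigma>_def field_simps)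
      have "k + \<sigma> * (x - x) \<le> Y n x"
      proof (rule comparison_le[where a = s and b = x and
      u = "\<lambda>t. k + \<sigma> * (t - x)" and v = "Y n"])
        have "- M * (s - a) \<le> Y n s" using lower[of a s n] Ya[of n] \<eta> s x x01 r0 by auto
        then show "k + \<sigma> * (s - x) \<le> Y n s" using \<sigma>1 s(4) by (simp add: algebra_simps)
        fix t assume t: "s < t" "t < x" "Y n t < k + \<sigma> * (t - x)"
        have "\<sigma> * (t - x) \<le> 0" using t \<sigma>0 by (simp add: mult_le_0_iff)
        then have "max (Y n t) (e n) \<le> k" using t n by auto
        moreover have "m \<le> P t" unfolding m_def by (rule u) (use s t x in auto)
        ultimately have "m / k \<le> P t / max (Y n t) (e n)"
          using m0 k e0[of n] by (intro frac_le) auto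
        then have "\<sigma> \<le> F n t (Y n t)" using M[of t] \<sigma> t s x x01 r0 by (simp add: F_def)
        moreover have "((\<lambda>t. k + \<sigma> * (t - x)) has_real_derivative \<sigma>) (at t)"
          by (auto intro!: derivative_eq_intros)
        ultimately show "\<exists>du dv. ((\<lambda>t. k + \<sigma> * (t - x)) has_real_derivative du) (at t) \<and>
          (Y n has_real_derivative dv) (at t) \<and> du \<le> dv"
          using dY[of t n] t s x x01 r0 by (intro exI[of _ "F n t (Y n t)"] exI[of _ \<sigma>]) auto
      qed (use s x x01 r0 in \<open>auto intro!: continuous_intros csub\<close>)
      then show ?thesis by simp
    qed
    then show ?thesis using k by blast
  qed
  have "\<exists>l. (\<lambda>n. Y n x) \<longlonglongrightarrow> l" if x: "x \<in> {a..b}" for x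
  proof -
    have "incseq (\<lambda>n. Y n x)" by (rule incseq_SucI) (rule mono[OF x])
    moreover have "Y n x \<le> max \<eta> 0 + 1 + (M + M / 1) * (x - a)" for n
      using upper[of a x 1 n] x Ya[of n] by auto
    ultimately show ?thesis using incseq_convergent by blast
  qed
  then obtain y where y: "\<And>x. x \<in> {a..b} \<Longrightarrow> (\<lambda>n. Y n x) \<longlonglongrightarrow> y x" by metis
  have ya: "y a = \<eta>"
    using y[of a] ab Ya by (simp add: LIMSEQ_const_iff)
  have y_upper: "y x' \<le> max (y x) 0 + k + (M + M / k) * (x' - x)"
    if x: "a \<le> x" "x \<le> x'" "x' \<le> b" and k: "0 < k" for x x' k
    by (rule tendsto_le[OF _ _ y[of x'],
          where f = "\<lambda>n. max (Y n x) 0 + k + (M + M / k) * (x' - x)"])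
      (use upper[OF x k] x in \<open>auto intro!: tendsto_intros y\<close>)
  have y_lower: "y x - M * (x' - x) \<le> y x'"
    if x: "a \<le> x" "x \<le> x'" "x' \<le> b" for x x'
    by (rule tendsto_le[OF _ y[of x'], where g = "\<lambda>n. Y n x - M * (x' - x)"])
      (use lower[OF x] x in \<open>auto intro!: tendsto_intros y\<close>)
  have elarge: "\<exists>N. \<forall>n\<ge>N. e n \<le> k" if "0 < k" for k
    using order_tendstoD(2)[OF elim that] unfolding eventually_sequentially by (meson less_imp_le)
  have y_pos: "0 < y x" if x: "x \<in> {a<..<b}" for x
  proof -
    obtain k where k: "0 < k" "\<And>n t. e n \<le> k \<Longrightarrow> t \<in> {x..(x + b) / 2} \<Longrightarrow> k \<le> Y n t"
      using pos[of x "(x + b) / 2"] x by auto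
    obtain N where N: "\<And>n. n \<ge> N \<Longrightarrow> e n \<le> k" using elarge[OF k(1)] by blast
    have "k \<le> y x"
      by (rule tendsto_lowerbound[OF y[of x]])
        (use x k N in \<open>auto simp: eventually_sequentially intro!: exI[of _ N]\<close>)
    then show ?thesis using k by simp
  qed
  have y_nonneg: "0 \<le> y x" if x: "x \<in> {a..b}" for x
  proof (cases "x = b")
    case True
    have "- y b \<le> 0 + \<epsilon>" if "0 < \<epsilon>" for \<epsilon>
    proof -
      define d where "d = min ((b - a) / 2) (\<epsilon> / M)"
      have d: "0 < d" "d < b - a" "d \<le> \<epsilon> / M"
        using ab that M0 min.cobounded1[of "(b - a) / 2" "\<epsilon> / M"]
          min.cobounded2[of "(b - a) / 2" "\<epsilon> / M"]
        by (simp_all add: d_def)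
      have "M * d \<le> \<epsilon>" using d M0 by (simp add: field_simps)
      then show ?thesis using y_lower[of "b - d" b] y_pos[of "b - d"] d by simp
    qed
    then have "- y b \<le> 0" by (rule field_le_epsilon)
    then show ?thesis using True by simp
  next
    case False
    then show ?thesis using y_pos[of x] x ya \<eta> by (cases "x = a") auto
  qed
  \<comment> \<open>Taking half of \<epsilon> for k in \<open>y_upper\<close> leaves a linear term
    with constant C; together with the linear lower bound this gives a modulus valid at every point,
    including zeros of y.\<close>
  have cy: "continuous_on {a..b} y"
    unfolding continuous_on_iff
  proof (intro ballI allI impI)
    fix x \<epsilon> :: real assume x: "x \<in> {a..b}" and \<epsilon>: "0 < \<epsilon>"
    define C where "C = M + M / (\<epsilon> / 2)"
    have C: "0 < C" "M \<le> C" using M0 \<epsilon> by (auto simp: C_def intro: add_pos_pos)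
    show "\<exists>d>0. \<forall>x'\<in>{a..b}. dist x' x < d \<longrightarrow> dist (y x') (y x) < \<epsilon>"
    proof (intro exI conjI ballI impI)
      show "0 < \<epsilon> / 2 / C" using C \<epsilon> by simp
      fix x' assume x': "x' \<in> {a..b}" "dist x' x < \<epsilon> / 2 / C"
      have *: "\<bar>y v - y u\<bar> < \<epsilon>" if u: "u \<in> {a..b}" "v \<in> {a..b}" "u \<le> v" "v - u < \<epsilon> / 2 / C" for u v
      proof -
        have c: "C * (v - u) < \<epsilon> / 2" using u C by (simp add: field_simps)
        have "M * (v - u) \<le> C * (v - u)" using u C by (intro mult_right_mono) auto
        moreover have "y v \<le> y u + \<epsilon> / 2 + C * (v - u)"
          using y_upper[of u v "\<epsilon> / 2"] u \<epsilon> y_nonneg[of u] by (simp add: C_def)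
        moreover have "y u - M * (v - u) \<le> y v" using y_lower[of u v] u by simp
        ultimately show ?thesis using c \<epsilon> by linarith
      qed
      show "dist (y x') (y x) < \<epsilon>"
        using *[of x x'] *[of x' x] x x' by (cases "x \<le> x'") (auto simp: dist_real_def)
    qed
  qed
  have "(y has_real_derivative A x + P x / y x) (at x)" if x: "x \<in> {a<..<b}" for x
  proof -
    define x0 x1 where "x0 = (a + x) / 2" and "x1 = (x + b) / 2"
    have x01: "a < x0" "x0 < x" "x < x1" "x1 < b" using x by (auto simp: x0_def x1_def)
    obtain k where k: "0 < k" "\<And>n t. e n \<le> k \<Longrightarrow> t \<in> {x0..x1} \<Longrightarrow> k \<le> Y n t"
      using pos[of x0 x1] x01 by auto
    obtain N where N: "\<And>n. n \<ge> N \<Longrightarrow> e n \<le> k" using elarge[OF k(1)] by blast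
    have sub: "{x0..x1} \<subseteq> {a<..<b}" using x01 by auto
    have sub': "{x0..x1} \<subseteq> {a..b}" using x01 by auto
    have cg: "continuous_on {x0..x1} (\<lambda>t. A t + P t / y t)"
      using y_pos sub
      by (intro continuous_intros continuous_on_subset[OF A sub'] continuous_on_subset[OF P sub']
          continuous_on_subset[OF cy sub']) (auto simp: subset_iff less_imp_neq[symmetric])
    \<comment> \<open>From index N on the approximations stay above k on this subinterval, so the
      floor is inactive and \<open>M + M / k\<close> dominates the integrands.\<close>
    have eq: "y t = y x0 + integral {x0..t} (\<lambda>t. A t + P t / y t)" if t: "t \<in> {x0..x1}" for t
    proof -
      have subt: "s \<in> {x0..x1}" "s \<in> {a..b}" if "s \<in> {x0..t}" for s using that t x01 by auto
      have fn: "((\<lambda>s. A s + P s / Y (n + N) s) has_integral (Y (n + N) t - Y (n + N) x0)) {x0..t}" for n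
      proof (rule fundamental_theorem_of_calculus)
        fix s assume s: "s \<in> {x0..t}"
        have "max (Y (n + N) s) (e (n + N)) = Y (n + N) s"
          using k(2)[OF N subt(1)[OF s], of "n + N"] N[of "n + N"] by auto
        then have "(Y (n + N) has_real_derivative A s + P s / Y (n + N) s) (at s)"
          using dY[of s "n + N"] subt[OF s] sub by (auto simp: F_def)
        then show "(Y (n + N) has_vector_derivative A s + P s / Y (n + N) s) (at s within {x0..t})"
          by (simp add: has_real_derivative_iff_has_vector_derivative has_vector_derivative_at_within)
      qed (use t in auto)
      have "(\<lambda>n. integral {x0..t} (\<lambda>s. A s + P s / Y (n + N) s)) \<longlonglongrightarrow>
              integral {x0..t} (\<lambda>s. A s + P s / y s)"
      proof (rule dominated_convergence(2)[where h = "\<lambda>_. M + M / k"])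
        show "(\<lambda>s. A s + P s / Y (n + N) s) integrable_on {x0..t}" for n using fn[of n] by blast
        fix s assume s: "s \<in> {x0..t}"
        show "norm (A s + P s / Y (n + N) s) \<le> M + M / k" for n
        proof -
          have Yk: "k \<le> Y (n + N) s" using k(2)[OF N subt(1)[OF s], of "n + N"] by simp
          have "0 \<le> P s / Y (n + N) s" using P0[OF subt(2)[OF s]] Yk k by simp
          moreover have "P s / Y (n + N) s \<le> M / k"
            using P0[OF subt(2)[OF s]] M[OF subt(2)[OF s]] Yk k M0 by (intro frac_le) auto
          ultimately show ?thesis using M[OF subt(2)[OF s]] by auto
        qed
        show "(\<lambda>n. A s + P s / Y (n + N) s) \<longlonglongrightarrow> A s + P s / y s"
          using y_pos[of s] subt[OF s] sub
          by (intro tendsto_intros LIMSEQ_ignore_initial_segment[OF y]) auto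
      qed auto
      moreover have "(\<lambda>n. integral {x0..t} (\<lambda>s. A s + P s / Y (n + N) s)) \<longlonglongrightarrow> y t - y x0"
        unfolding integral_unique[OF fn]
        by (intro tendsto_intros LIMSEQ_ignore_initial_segment[OF y]) (use x01 t in auto)
      ultimately show ?thesis using LIMSEQ_unique by fastforce
    qed
    have "((\<lambda>t. y x0 + integral {x0..t} (\<lambda>t. A t + P t / y t)) has_real_derivative A x + P x / y x)
            (at x within {x0..x1})"
      using DERIV_add[OF DERIV_const integral_has_real_derivative[OF cg, of x], of "y x0"] x01 by simp
    then have "(y has_real_derivative A x + P x / y x) (at x within {x0..x1})"
      by (rule has_field_derivative_transform_within[where d = 1]) (use x01 in \<open>simp_all add: eq[symmetric]\<close>)
    then show ?thesis using x01 by (simp add: at_within_Icc_at)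
  qed
  then show ?thesis using cy y_pos ya unfolding positive_sol_def by blast
qed

section \<open>Arrival at zero and dependence on the speed\<close>

text \<open>The supersolution is \<open>F t - F b - sqrt S * (b - t)\<close>. Of the two copies of
  \<open>sqrt S\<close> in the hypothesis on F, one is spent as its derivative surplus over A. The
  other keeps it above \<open>sqrt S * (b - t)\<close>, so that P divided by it is at most
  \<open>sqrt S\<close>, precisely the surplus.\<close>

lemma positive_sol_landing:
  assumes y: "positive_sol A P a b y" and ab: "a < b"
    and P0: "\<And>t. t \<in> {a<..<b} \<Longrightarrow> 0 \<le> P t" and S: "0 < S"
    and F: "continuous_on {a..b} F" "\<And>t. t \<in> {a<..<b} \<Longrightarrow> (F has_real_derivative A t) (at t)"
    and mean: "\<And>t. t \<in> {a..<b} \<Longrightarrow> F b - F t \<le> - 2 * sqrt S * (b - t)"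
    and P: "\<And>t. t \<in> {a<..<b} \<Longrightarrow> P t \<le> S * (b - t)"
    and init: "y a \<le> sqrt S * (b - a)"
  shows "y b = 0"
proof -
  define Z where "Z t = F t - F b - sqrt S * (b - t)" for t
  have Zge: "sqrt S * (b - t) \<le> Z t" if "t \<in> {a..<b}" for t
    using mean[OF that] by (simp add: Z_def)
  have "y b \<le> Z b"
  proof (rule positive_sol_le_supersolution[OF y P0])
    show "continuous_on {a..b} Z" unfolding Z_def by (intro continuous_intros F)
    show "y a \<le> Z a" using Zge[of a] init ab by simp
    fix t assume t: "t \<in> {a<..<b}"
    have pos: "0 < sqrt S * (b - t)" using S t by simp
    have "P t / Z t \<le> S * (b - t) / (sqrt S * (b - t))"
      using P[OF t] P0[OF t] Zge[of t] t pos S by (intro frac_le) auto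
    also have "\<dots> = sqrt S" using t S by (simp add: real_div_sqrt)
    finally have "A t + P t / Z t \<le> A t + sqrt S" by simp
    moreover have "(Z has_real_derivative A t + sqrt S) (at t)"
      unfolding Z_def using F(2)[OF t] by (auto intro!: derivative_eq_intros)
    ultimately show "0 < Z t \<and> (\<exists>d. (Z has_real_derivative d) (at t) \<and> A t + P t / Z t \<le> d)"
      using Zge[of t] t pos by auto
  qed (use ab in auto)
  then show ?thesis using positive_sol_end_nonneg[OF y ab] by (simp add: Z_def)
qed

text \<open>Suppose y reaches 0 at b. Near b one has A > -e, hence y' > -e and y \<le> e (b - t).
  The source is then at least m / e, which exceeds e by the choice e = sqrt (m / 2). So y is
  nondecreasing up to b, although it is positive before and 0 at b.\<close>

lemma positive_sol_no_touch:
  assumes y: "positive_sol A P a b y" and ab: "a < b"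
    and A: "continuous_on {a..b} A" "0 \<le> A b"
    and P: "0 < m" "0 < d" "\<And>t. t \<in> {a<..<b} \<Longrightarrow> b - d < t \<Longrightarrow> m * (b - t) \<le> P t"
  shows "y b \<noteq> 0"
proof
  assume yb: "y b = 0"
  define e where "e = sqrt (m / 2)"
  have e: "0 < e" "e * e < m" using P by (auto simp: e_def)
  obtain d' where d': "0 < d'" "\<And>t. t \<in> {a..b} \<Longrightarrow> dist t b < d' \<Longrightarrow> dist (A t) (A b) < e"
    using A(1) ab e(1) unfolding continuous_on_iff by (metis atLeastAtMost_iff less_imp_le order_refl)
  define t0 where "t0 = max ((a + b) / 2) (b - min d d' / 2)"
  have t0: "a < t0" "t0 < b" "b - d < t0" "b - d' < t0"
    using ab P d' by (auto simp: t0_def min_def max_def field_simps)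
  have cy: "continuous_on {s..b} y" if "a \<le> s" for s
    using y that by (auto simp: positive_sol_def intro: continuous_on_subset)
  have ypos: "0 < y t" and dy: "(y has_real_derivative A t + P t / y t) (at t)"
    if "t0 \<le> t" "t < b" for t
    using y that t0 by (auto simp: positive_sol_def)
  have Ae: "- e < A t" if "t0 \<le> t" "t < b" for t
    using d'(2)[of t] that t0 A by (auto simp: dist_real_def)
  have Pm: "m * (b - t) \<le> P t" if "t0 \<le> t" "t < b" for t
    using P(3)[of t] that t0 by auto
  have ub: "y t \<le> e * (b - t)" if t: "t0 \<le> t" "t < b" for t
  proof -
    have "y t + e * t \<le> y b + e * b"
    proof (rule DERIV_nonneg_imp_increasing_open[of t b "\<lambda>t. y t + e * t"])
      fix s assume s: "t < s" "s < b"
      have "0 \<le> m * (b - s)" using P s by simp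
      then have "0 \<le> P s / y s" using Pm[of s] ypos[of s] s t by simp
      then show "\<exists>z. ((\<lambda>t. y t + e * t) has_real_derivative z) (at s) \<and> 0 \<le> z"
        using dy[of s] Ae[of s] s t
        by (intro exI[of _ "A s + P s / y s + e"]) (auto intro!: derivative_eq_intros)
    qed (use t t0 in \<open>auto intro!: continuous_intros cy\<close>)
    then show ?thesis using yb by (simp add: algebra_simps)
  qed
  have "y t0 \<le> y b"
  proof (rule DERIV_nonneg_imp_increasing_open[of t0 b y])
    fix s assume s: "t0 < s" "s < b"
    have "e * (e * (b - s)) \<le> m * (b - s)"
      using e s mult_right_mono[of "e * e" m "b - s"] by (simp add: mult.assoc)
    moreover have "e * y s \<le> e * (e * (b - s))" using ub[of s] s e by simp
    ultimately have "e * y s \<le> P s" using Pm[of s] s by linarith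
    then have "e \<le> P s / y s" using ypos[of s] s by (simp add: pos_le_divide_eq)
    then show "\<exists>z. (y has_real_derivative z) (at s) \<and> 0 \<le> z"
      using dy[of s] Ae[of s] s by (intro exI[of _ "A s + P s / y s"]) auto
  qed (use t0 cy in auto)
  then show False using ypos[of t0] yb t0 by simp
qed

text \<open>The shift c plays the role of the speed. Monotonicity, a Lipschitz bound and linear
  growth of the end value in c are what an intermediate value argument for the speed
  requires.\<close>

lemma positive_sol_family:
  fixes A P :: "real \<Rightarrow> real"
  assumes ab: "a < b" and A: "continuous_on {a..b} A" and P: "continuous_on {a..b} P"
    and P0: "\<And>t. t \<in> {a..b} \<Longrightarrow> 0 \<le> P t" and Ppos: "\<And>t. t \<in> {a<..<b} \<Longrightarrow> 0 < P t"
  shows "\<exists>Y B. (\<forall>c. positive_sol (\<lambda>t. A t + c) P a b (Y c) \<and> Y c a = 0) \<and>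
    (\<forall>c1 c2. c1 \<le> c2 \<longrightarrow> Y c1 b \<le> Y c2 b \<and> Y c2 b \<le> Y c1 b + (c2 - c1) * (b - a)) \<and>
    (\<forall>c. (c - B) * (b - a) \<le> Y c b)"
proof -
  have "\<exists>y. positive_sol (\<lambda>t. A t + c) P a b y \<and> y a = 0" for c
    by (rule positive_sol_exists[OF ab _ P P0 Ppos]) (auto intro!: continuous_intros A)
  then obtain Y where Y: "\<And>c. positive_sol (\<lambda>t. A t + c) P a b (Y c)" and Ya: "\<And>c. Y c a = 0"
    by metis
  have cY: "continuous_on {a..b} (Y c)" for c using Y[of c] by (simp add: positive_sol_def)
  have pY: "0 < Y c t" and dY: "(Y c has_real_derivative A t + c + P t / Y c t) (at t)"
    if "t \<in> {a<..<b}" for c t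
    using Y[of c] that by (auto simp: positive_sol_def)
  obtain B where B: "\<And>t. t \<in> {a..b} \<Longrightarrow> norm (A t) \<le> B"
    using compact_imp_bounded[OF compact_continuous_image[OF A]] unfolding bounded_iff by blast
  have "Y c1 b \<le> Y c2 b" if c: "c1 \<le> c2" for c1 c2
  proof (rule positive_sol_le_supersolution[OF Y])
    fix t assume t: "t \<in> {a<..<b}"
    show "0 < Y c2 t \<and> (\<exists>d. (Y c2 has_real_derivative d) (at t) \<and> A t + c1 + P t / Y c2 t \<le> d)"
      using pY[OF t] dY[OF t] c by (intro conjI exI[of _ "A t + c2 + P t / Y c2 t"]) auto
  qed (use ab Ya cY P0 in auto)
  \<comment> \<open>Adding the accumulated excess \<open>(c2 - c1) * (t - a)\<close> to the solution
    for c1 gives a supersolution for c2, because a larger y has a smaller source.\<close>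
  moreover have "Y c2 b \<le> Y c1 b + (c2 - c1) * (b - a)" if c: "c1 \<le> c2" for c1 c2
  proof (rule positive_sol_le_supersolution[OF Y, where Z = "\<lambda>t. Y c1 t + (c2 - c1) * (t - a)"])
    fix t assume t: "t \<in> {a<..<b}"
    let ?Z = "Y c1 t + (c2 - c1) * (t - a)"
    have "0 \<le> (c2 - c1) * (t - a)" using t c by simp
    then have Z: "Y c1 t \<le> ?Z" by simp
    have "P t / ?Z \<le> P t / Y c1 t" using Z pY[OF t, of c1] P0[of t] t by (intro divide_left_mono) auto
    moreover have "((\<lambda>t. Y c1 t + (c2 - c1) * (t - a)) has_real_derivative
        A t + c1 + P t / Y c1 t + (c2 - c1)) (at t)"
      using dY[OF t, of c1] by (auto intro!: derivative_eq_intros)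
    ultimately show "0 < ?Z \<and> (\<exists>d. ((\<lambda>t. Y c1 t + (c2 - c1) * (t - a)) has_real_derivative d) (at t)
        \<and> A t + c2 + P t / ?Z \<le> d)"
      using Z pY[OF t, of c1]
      by (intro conjI exI[of _ "A t + c1 + P t / Y c1 t + (c2 - c1)"]) auto
  qed (use ab Ya cY P0 in \<open>auto intro!: continuous_intros\<close>)
  \<comment> \<open>Discarding the nonnegative source leaves \<open>Y' \<ge> c - B\<close>.\<close>
  moreover have "(c - B) * (b - a) \<le> Y c b" for c
  proof -
    have "Y c a - (c - B) * a \<le> Y c b - (c - B) * b"
    proof (rule DERIV_nonneg_imp_increasing_open[of a b "\<lambda>t. Y c t - (c - B) * t"])
      fix t assume t: "a < t" "t < b"
      have "0 \<le> P t / Y c t" using P0[of t] pY[of t c] t by simp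
      then show "\<exists>z. ((\<lambda>t. Y c t - (c - B) * t) has_real_derivative z) (at t) \<and> 0 \<le> z"
        using dY[of t c] B[of t] t
        by (intro exI[of _ "A t + c + P t / Y c t - (c - B)"]) (auto intro!: derivative_eq_intros)
    qed (use ab cY in \<open>auto intro!: continuous_intros\<close>)
    then show ?thesis using Ya[of c] by (simp add: algebra_simps)
  qed
  ultimately show ?thesis using Y Ya by (intro exI[of _ Y] exI[of _ B]) auto
qed

lemma positive_sol_minus_deriv:
  assumes "positive_sol A P a b y" "t \<in> {a<..<b}"
  shows "((\<lambda>t. - y t) has_real_derivative - A t + P t / - y t) (at t)"
  using DERIV_minus[of y "A t + P t / y t"] assms by (auto simp: positive_sol_def)

lemma positive_sol_reflect_deriv:
  assumes "positive_sol A P a b y" "- t \<in> {a<..<b}"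
  shows "((\<lambda>t. y (- t)) has_real_derivative - A (- t) - P (- t) / y (- t)) (at t)"
proof -
  have "(y has_real_derivative A (- t) + P (- t) / y (- t)) (at (- t))"
    using assms by (auto simp: positive_sol_def)
  then show ?thesis by (simp add: DERIV_mirror)
qed

section \<open>From the flux to the profile\<close>

text \<open>A generalized inverse, the supremum of a superlevel set of X. Strict monotonicity of X
  excludes jumps of \<phi>; jumps of X turn into flat pieces of \<phi>. Where X has a finite limit
  at 0 or 1, \<phi> attains that end value on a half line.\<close>

lemma decreasing_inverse:
  fixes X :: "real \<Rightarrow> real"
  assumes X: "\<And>x y. 0 < x \<Longrightarrow> x < y \<Longrightarrow> y < 1 \<Longrightarrow> X y < X x"
  shows "\<exists>\<phi>. continuous_on UNIV \<phi> \<and> antimono \<phi> \<and> (\<forall>\<xi>. \<phi> \<xi> \<in> {0..1}) \<and>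
    (\<phi> \<longlongrightarrow> 1) at_bot \<and> (\<phi> \<longlongrightarrow> 0) at_top \<and> (\<forall>x\<in>{0<..<1}. \<phi> (X x) = x)"
proof -
  \<comment> \<open>The inserted 0 keeps the set nonempty and supplies the value of \<phi> to the
    right of the range of X.\<close>
  define S where "S \<xi> = insert 0 {x. 0 < x \<and> x < 1 \<and> \<xi> \<le> X x}" for \<xi>
  define \<phi> where "\<phi> \<xi> = Sup (S \<xi>)" for \<xi>
  have bdd: "bdd_above (S \<xi>)" for \<xi> by (rule bdd_aboveI[of _ 1]) (auto simp: S_def)
  have ne: "S \<xi> \<noteq> {}" for \<xi> by (auto simp: S_def)
  have range: "0 \<le> \<phi> \<xi>" "\<phi> \<xi> \<le> 1" for \<xi>
  proof -
    show "0 \<le> \<phi> \<xi>" unfolding \<phi>_def by (rule cSup_upper[OF _ bdd]) (simp add: S_def)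
    show "\<phi> \<xi> \<le> 1" unfolding \<phi>_def by (rule cSup_least[OF ne]) (auto simp: S_def)
  qed
  have ge: "x \<le> \<phi> \<xi>" if "0 < x" "x < 1" "\<xi> \<le> X x" for x \<xi>
    unfolding \<phi>_def by (rule cSup_upper[OF _ bdd]) (use that in \<open>auto simp: S_def\<close>)
  have le: "\<phi> \<xi> \<le> x" if x: "0 < x" "x < 1" "X x \<le> \<xi>" for x \<xi>
    unfolding \<phi>_def
  proof (rule cSup_least[OF ne])
    fix y assume "y \<in> S \<xi>"
    then show "y \<le> x" using X[of x y] x by (force simp: S_def)
  qed
  have inv: "\<phi> (X x) = x" if "0 < x" "x < 1" for x
    using ge[of x "X x"] le[of x "X x"] that by auto
  have mono: "antimono \<phi>"
  proof (rule antimonoI)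
    fix u v :: real assume "u \<le> v"
    then have "S v \<subseteq> S u" by (auto simp: S_def)
    then show "\<phi> v \<le> \<phi> u" unfolding \<phi>_def by (rule cSup_subset_mono[OF ne bdd])
  qed
  have "(\<phi> \<longlongrightarrow> 1) at_bot"
  proof (rule order_tendstoI)
    fix a :: real assume a: "a < 1"
    define x where "x = (max 0 a + 1) / 2"
    have x: "0 < x" "x < 1" "a < x" using a by (auto simp: x_def max_def)
    have "eventually (\<lambda>\<xi>. \<xi> \<le> X x) at_bot" by (rule eventually_le_at_bot)
    then show "eventually (\<lambda>\<xi>. a < \<phi> \<xi>) at_bot"
      by eventually_elim (rule less_le_trans[OF x(3) ge[OF x(1,2)]])
  next
    fix a :: real assume "1 < a"
    then show "eventually (\<lambda>\<xi>. \<phi> \<xi> < a) at_bot"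
      using range(2) by (intro always_eventually) (metis le_less_trans)
  qed
  moreover have "(\<phi> \<longlongrightarrow> 0) at_top"
  proof (rule order_tendstoI)
    fix a :: real assume a: "0 < a"
    define x where "x = min a 1 / 2"
    have x: "0 < x" "x < 1" "x < a" using a by (auto simp: x_def min_def)
    have "eventually (\<lambda>\<xi>. X x \<le> \<xi>) at_top" by (rule eventually_ge_at_top)
    then show "eventually (\<lambda>\<xi>. \<phi> \<xi> < a) at_top"
      by eventually_elim (rule le_less_trans[OF le[OF x(1,2)] x(3)])
  next
    fix a :: real assume "a < 0"
    then show "eventually (\<lambda>\<xi>. a < \<phi> \<xi>) at_top"
      using range(1) by (intro always_eventually) (metis less_le_trans)
  qed
  moreover have "continuous_on UNIV \<phi>"
    unfolding continuous_on_def
  proof (intro ballI, rule order_tendstoI)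
    fix \<xi> a :: real assume a: "a < \<phi> \<xi>"
    show "eventually (\<lambda>\<xi>'. a < \<phi> \<xi>') (at \<xi> within UNIV)"
    proof (cases "a < 0")
      case True
      then show ?thesis using range(1) by (intro always_eventually) (metis less_le_trans)
    next
      case False
      define x where "x = (a + \<phi> \<xi>) / 2"
      have x: "0 < x" "x < 1" "a < x" "x < \<phi> \<xi>" using a False range(2)[of \<xi>] by (auto simp: x_def)
      have "\<xi> < X x" using le[of x \<xi>] x by force
      then have "eventually (\<lambda>\<xi>'. \<xi>' < X x) (at \<xi> within UNIV)"
        by (rule order_tendstoD(2)[OF tendsto_ident_at])
      then show ?thesis by eventually_elim (rule less_le_trans[OF x(3) ge[OF x(1,2) less_imp_le]])
    qed
  next
    fix \<xi> a :: real assume a: "\<phi> \<xi> < a"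
    show "eventually (\<lambda>\<xi>'. \<phi> \<xi>' < a) (at \<xi> within UNIV)"
    proof (cases "1 < a")
      case True
      then show ?thesis using range(2) by (intro always_eventually) (metis le_less_trans)
    next
      case False
      define x where "x = (a + \<phi> \<xi>) / 2"
      have x: "0 < x" "x < 1" "x < a" "\<phi> \<xi> < x" using a False range(1)[of \<xi>] by (auto simp: x_def)
      have "X x < \<xi>" using ge[of x \<xi>] x by force
      then have "eventually (\<lambda>\<xi>'. X x < \<xi>') (at \<xi> within UNIV)"
        by (rule order_tendstoD(1)[OF tendsto_ident_at])
      then show ?thesis by eventually_elim (rule le_less_trans[OF le[OF x(1,2) less_imp_le] x(3)])
    qed
  qed
  ultimately show ?thesis using mono range inv by (intro exI[of _ \<phi>]) auto
qed

text \<open>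
  A profile may reach the values 0 and 1 at finite points, and the derivative of \<open>\<phi>\<close> or of the flux
  may fail to exist where \<open>\<phi>\<close> takes the values \<open>\<alpha>\<close> and \<open>\<gamma>\<close>; these finitely many points are harmless for
  the weak formulation because the flux \<open>z \<circ> \<phi>\<close> is continuous.
\<close>
lemma wavefront_of_flux:
  fixes f D g z X :: "real \<Rightarrow> real"
  assumes \<alpha>: "0 < \<alpha>" "\<alpha> < 1" and \<gamma>: "0 < \<gamma>" "\<gamma> < 1"
    and f: "continuous_on {0..1} f" "\<And>x. x \<in> {0<..<1} \<Longrightarrow> (f has_real_derivative f' x) (at x)"
    and g: "continuous_on {0..1} g" "g 0 = 0" "g 1 = 0"
    and z: "continuous_on {0..1} z" "z 0 = 0" "z \<alpha> = 0" "z 1 = 0"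
    and Dz: "\<And>x. x \<in> {0<..<1} - {\<alpha>} \<Longrightarrow> D x * z x < 0"
    and dz: "\<And>x. x \<in> {0<..<1} - {\<alpha>, \<gamma>} \<Longrightarrow>
      (z has_real_derivative f' x - c - D x * g x / z x) (at x)"
    and X: "continuous_on {0<..<1} X"
    and dX: "\<And>x. x \<in> {0<..<1} - {\<alpha>} \<Longrightarrow> (X has_real_derivative D x / z x) (at x)"
  shows "\<exists>\<phi>. wavefront f D g c \<phi>"
proof -
  have DzX: "D x / z x < 0" "z x \<noteq> 0" "D x \<noteq> 0" if "x \<in> {0<..<1} - {\<alpha>}" for x
    using Dz[OF that] by (auto simp: mult_less_0_iff divide_less_0_iff)
  \<comment> \<open>The sign of the derivative is known only off \<alpha>; monotonicity across
    \<alpha> comes from joining the two sides by continuity of X.\<close>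
  have seg: "X y < X x" if "0 < x" "x < y" "y < 1" "\<alpha> \<notin> {x<..<y}" for x y
  proof (rule DERIV_neg_imp_decreasing_open[of x y X])
    fix t assume "x < t" "t < y"
    then have "t \<in> {0<..<1} - {\<alpha>}" using that by auto
    then show "\<exists>d. (X has_real_derivative d) (at t) \<and> d < 0" using dX DzX by blast
  qed (use that in \<open>auto intro: continuous_on_subset[OF X]\<close>)
  have Xdec: "X y < X x" if "0 < x" "x < y" "y < 1" for x y
  proof (cases "\<alpha> \<in> {x<..<y}")
    case True
    then show ?thesis using seg[of x \<alpha>] seg[of \<alpha> y] that by auto
  next
    case False
    then show ?thesis by (intro seg that)
  qed
  have "\<exists>\<phi>. continuous_on UNIV \<phi> \<and> antimono \<phi> \<and> (\<forall>\<xi>. \<phi> \<xi> \<in> {0..1}) \<and>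
    (\<phi> \<longlongrightarrow> 1) at_bot \<and> (\<phi> \<longlongrightarrow> 0) at_top \<and> (\<forall>x\<in>{0<..<1}. \<phi> (X x) = x)"
    by (rule decreasing_inverse) (rule Xdec)
  then obtain \<phi> where
    c\<phi>: "continuous_on UNIV \<phi>" and anti: "antimono \<phi>" and range: "\<And>\<xi>. \<phi> \<xi> \<in> {0..1}"
    and bot: "(\<phi> \<longlongrightarrow> 1) at_bot" and top: "(\<phi> \<longlongrightarrow> 0) at_top"
    and inv: "\<And>x. x \<in> {0<..<1} \<Longrightarrow> \<phi> (X x) = x"
    by auto
  have iso: "isCont \<phi> \<xi>" for \<xi> using c\<phi> by (simp add: continuous_on_eq_continuous_at)
  have nbhd: "eventually (\<lambda>\<xi>'. \<phi> \<xi>' \<in> U) (nhds \<xi>)" if "open U" "\<phi> \<xi> \<in> U" for U \<xi>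
    using iso[of \<xi>] that unfolding continuous_within eventually_nhds_conv_at
    by (auto simp: tendsto_def eventually_at_filter)
  have Xinv: "X (\<phi> \<xi>) = \<xi>" if "\<phi> \<xi> \<in> {0<..<1}" for \<xi>
  proof (rule ccontr)
    assume ne: "X (\<phi> \<xi>) \<noteq> \<xi>"
    define x where "x = \<phi> \<xi>"
    have x: "x \<in> {0<..<1}" "\<phi> (X x) = x" using that inv by (auto simp: x_def)
    text \<open>Since \<open>X\<close> is strictly decreasing and \<open>\<phi>\<close> is antitone, \<open>\<phi>\<close> equals \<open>x\<close> between \<open>X x\<close>
      and \<open>\<xi>\<close>, so \<open>X\<close> would have a jump at \<open>x\<close>.\<close>
    show False
    proof (cases "X x < \<xi>")
      case True
      have "isCont X x" using X x by (simp add: continuous_on_eq_continuous_at)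
      then have "eventually (\<lambda>t. X t < \<xi>) (at x)" using True unfolding isCont_def by (rule order_tendstoD)
      then have "eventually (\<lambda>t. X t < \<xi>) (at_left x)" by (rule filter_leD[OF at_le, rotated]) auto
      moreover have "eventually (\<lambda>t. 0 < t \<and> t < x) (at_left x)"
        using x by (auto simp: eventually_at_left_field intro!: exI[of _ 0])
      ultimately have "eventually (\<lambda>t. X t < \<xi> \<and> 0 < t \<and> t < x) (at_left x)" by eventually_elim auto
      then obtain t where t: "X t < \<xi>" "0 < t" "t < x"
        using eventually_happens[of _ "at_left x"] by auto
      then have "\<phi> \<xi> \<le> \<phi> (X t)" using anti by (auto simp: antimono_def)
      then show False using inv[of t] t x x_def by auto
    next
      case False
      then have F: "\<xi> < X x" using ne by (simp add: x_def)
      have "isCont X x" using X x by (simp add: continuous_on_eq_continuous_at)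
      then have "eventually (\<lambda>t. \<xi> < X t) (at x)" using F unfolding isCont_def by (rule order_tendstoD)
      then have "eventually (\<lambda>t. \<xi> < X t) (at_right x)" by (rule filter_leD[OF at_le, rotated]) auto
      moreover have "eventually (\<lambda>t. x < t \<and> t < 1) (at_right x)"
        using x by (auto simp: eventually_at_right_field intro!: exI[of _ 1])
      ultimately have "eventually (\<lambda>t. \<xi> < X t \<and> x < t \<and> t < 1) (at_right x)" by eventually_elim auto
      then obtain t where t: "\<xi> < X t" "x < t" "t < 1"
        using eventually_happens[of _ "at_right x"] by auto
      then have "\<phi> (X t) \<le> \<phi> \<xi>" using anti by (auto simp: antimono_def)
      then show False using inv[of t] t x x_def by auto
    qed
  qed
  have d\<phi>: "(\<phi> has_real_derivative z (\<phi> \<xi>) / D (\<phi> \<xi>)) (at \<xi>)"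
    if \<xi>: "\<phi> \<xi> \<in> {0<..<1} - {\<alpha>}" for \<xi>
  proof -
    have "eventually (\<lambda>\<xi>'. \<phi> \<xi>' \<in> {0<..<1}) (nhds \<xi>)" using \<xi> by (intro nbhd) auto
    then obtain d where d: "0 < d" "\<And>\<xi>'. dist \<xi>' \<xi> < d \<Longrightarrow> \<phi> \<xi>' \<in> {0<..<1}"
      unfolding eventually_nhds_metric by blast
    have "(\<phi> has_real_derivative inverse (D (\<phi> \<xi>) / z (\<phi> \<xi>))) (at \<xi>)"
    proof (rule DERIV_inverse_function[where f = X and a = "\<xi> - d" and b = "\<xi> + d"])
      show "(X has_real_derivative D (\<phi> \<xi>) / z (\<phi> \<xi>)) (at (\<phi> \<xi>))" by (rule dX[OF \<xi>])
      show "D (\<phi> \<xi>) / z (\<phi> \<xi>) \<noteq> 0" using DzX[OF \<xi>] by simp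
      show "\<xi> - d < \<xi>" "\<xi> < \<xi> + d" using d by auto
      show "X (\<phi> y) = y" if "\<xi> - d < y" "y < \<xi> + d" for y
        by (rule Xinv[OF d(2)]) (use that in \<open>auto simp: dist_real_def\<close>)
      show "isCont \<phi> \<xi>" by (rule iso)
    qed
    then show ?thesis by (simp add: inverse_eq_divide)
  qed
  text \<open>On the level sets \<open>\<phi> = 0\<close> and \<open>\<phi> = 1\<close> only the boundary point is exceptional.\<close>
  define a1 where "a1 = Sup {\<xi>. \<phi> \<xi> = 1}"
  define a0 where "a0 = Inf {\<xi>. \<phi> \<xi> = 0}"
  \<comment> \<open>If \<phi> never attains 0 or 1, the corresponding \<open>a0\<close> or
    \<open>a1\<close> is an arbitrary number, which does no harm in a finite exceptional
    set.\<close>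
  define E where "E = {X \<alpha>, X \<gamma>, a0, a1}"
  have finE: "finite E" by (simp add: E_def)
  have flat1: "eventually (\<lambda>\<xi>'. \<phi> \<xi>' = 1) (nhds \<xi>)" if "\<phi> \<xi> = 1" "\<xi> \<notin> E" for \<xi>
  proof -
    have "\<phi> (X \<alpha>) = \<alpha>" using inv \<alpha> by simp
    have ub: "\<xi>' \<le> X \<alpha>" if "\<phi> \<xi>' = 1" for \<xi>'
    proof (rule ccontr)
      assume "\<not> \<xi>' \<le> X \<alpha>"
      then have "\<phi> \<xi>' \<le> \<phi> (X \<alpha>)" using anti by (auto simp: antimono_def)
      then show False using that \<open>\<phi> (X \<alpha>) = \<alpha>\<close> \<alpha> by simp
    qed
    then have bdd: "bdd_above {\<xi>. \<phi> \<xi> = 1}" by (intro bdd_aboveI[of _ "X \<alpha>"]) auto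
    have "\<xi> \<le> a1" unfolding a1_def by (rule cSup_upper[OF _ bdd]) (use that in auto)
    then have "\<xi> < a1" using that by (auto simp: E_def)
    moreover have "{\<xi>. \<phi> \<xi> = 1} \<noteq> {}" using that(1) by auto
    ultimately have "\<exists>\<eta>\<in>{\<xi>. \<phi> \<xi> = 1}. \<xi> < \<eta>"
      unfolding a1_def by (intro less_cSupD)
    then obtain \<eta> where \<eta>: "\<phi> \<eta> = 1" "\<xi> < \<eta>" by auto
    have "eventually (\<lambda>\<xi>'. \<xi>' < \<eta>) (nhds \<xi>)" using \<eta> eventually_nhds_in_open[of "{..<\<eta>}" \<xi>] by simp
    then show ?thesis
    proof eventually_elim
      case (elim \<xi>')
      then have "\<phi> \<eta> \<le> \<phi> \<xi>'" using anti by (auto simp: antimono_def)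
      then show ?case using \<eta> range[of \<xi>'] by auto
    qed
  qed
  have flat0: "eventually (\<lambda>\<xi>'. \<phi> \<xi>' = 0) (nhds \<xi>)" if "\<phi> \<xi> = 0" "\<xi> \<notin> E" for \<xi>
  proof -
    have "\<phi> (X \<alpha>) = \<alpha>" using inv \<alpha> by simp
    have lb: "X \<alpha> \<le> \<xi>'" if "\<phi> \<xi>' = 0" for \<xi>'
    proof (rule ccontr)
      assume "\<not> X \<alpha> \<le> \<xi>'"
      then have "\<phi> (X \<alpha>) \<le> \<phi> \<xi>'" using anti by (auto simp: antimono_def)
      then show False using that \<open>\<phi> (X \<alpha>) = \<alpha>\<close> \<alpha> by simp
    qed
    then have bdd: "bdd_below {\<xi>. \<phi> \<xi> = 0}" by (intro bdd_belowI[of _ "X \<alpha>"]) auto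
    have "a0 \<le> \<xi>" unfolding a0_def by (rule cInf_lower[OF _ bdd]) (use that in auto)
    then have "a0 < \<xi>" using that by (auto simp: E_def)
    moreover have "{\<xi>. \<phi> \<xi> = 0} \<noteq> {}" using that(1) by auto
    ultimately have "\<exists>\<eta>\<in>{\<xi>. \<phi> \<xi> = 0}. \<eta> < \<xi>"
      unfolding a0_def by (intro cInf_lessD)
    then obtain \<eta> where \<eta>: "\<phi> \<eta> = 0" "\<eta> < \<xi>" by auto
    have "eventually (\<lambda>\<xi>'. \<eta> < \<xi>') (nhds \<xi>)" using \<eta> eventually_nhds_in_open[of "{\<eta><..}" \<xi>] by simp
    then show ?thesis
    proof eventually_elim
      case (elim \<xi>')
      then have "\<phi> \<xi>' \<le> \<phi> \<eta>" using anti by (auto simp: antimono_def)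
      then show ?case using \<eta> range[of \<xi>'] by auto
    qed
  qed
  have E_cases: "\<phi> \<xi> = 0 \<or> \<phi> \<xi> = 1 \<or> \<phi> \<xi> \<in> {0<..<1} - {\<alpha>, \<gamma>}" if "\<xi> \<notin> E" for \<xi>
    using range[of \<xi>] Xinv[of \<xi>] that by (force simp: E_def)
  \<comment> \<open>With these values
    \<open>D (\<phi> \<xi>) * \<phi>' \<xi> = z (\<phi> \<xi>)\<close> holds at every point: z
    vanishes at 0, 1 and \<alpha>, so at level \<alpha> the quotient is 0 whatever D does
    there.\<close>
  define \<phi>' where "\<phi>' \<xi> = (if \<phi> \<xi> \<in> {0<..<1} then z (\<phi> \<xi>) / D (\<phi> \<xi>) else 0)" for \<xi>
  have flux: "D (\<phi> \<xi>) * \<phi>' \<xi> = z (\<phi> \<xi>)" for \<xi>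
  proof (cases "\<phi> \<xi> \<in> {0<..<1} - {\<alpha>}")
    case True
    then show ?thesis using DzX[of "\<phi> \<xi>"] by (simp add: \<phi>'_def)
  next
    case False
    then have "\<phi> \<xi> = 0 \<or> \<phi> \<xi> = 1 \<or> \<phi> \<xi> = \<alpha>" using range[of \<xi>] by auto
    then show ?thesis using z by (auto simp: \<phi>'_def)
  qed
  have d\<phi>': "(\<phi> has_real_derivative \<phi>' \<xi>) (at \<xi>)" if E: "\<xi> \<notin> E" for \<xi>
  proof -
    consider "\<phi> \<xi> = 0" | "\<phi> \<xi> = 1" | "\<phi> \<xi> \<in> {0<..<1} - {\<alpha>, \<gamma>}" using E_cases[OF E] by blast
    then show ?thesis
    proof cases
      case 1
      then show ?thesis
        using DERIV_cong_ev[OF refl flat0[OF 1 E] refl, of 0] by (simp add: \<phi>'_def)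
    next
      case 2
      then show ?thesis
        using DERIV_cong_ev[OF refl flat1[OF 2 E] refl, of 0] by (simp add: \<phi>'_def)
    next
      case 3
      then show ?thesis using d\<phi>[of \<xi>] by (simp add: \<phi>'_def)
    qed
  qed
  have comp: "continuous_on UNIV (\<lambda>\<xi>. h (\<phi> \<xi>))" if "continuous_on {0..1} h" for h :: "real \<Rightarrow> real"
    by (rule continuous_on_compose2[OF that c\<phi>]) (use range in auto)
  \<comment> \<open>W is the bracket of the weak formulation. The singular equation for z says that
    W has derivative \<open>- g \<circ> \<phi>\<close> off E, so the weak integrand is the
    derivative of \<open>W * \<psi>\<close> and its integral reduces to boundary terms.\<close>
  define W where "W \<xi> = z (\<phi> \<xi>) - f (\<phi> \<xi>) + c * \<phi> \<xi>" for \<xi>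
  have cW: "continuous_on UNIV W"
    unfolding W_def by (intro continuous_intros comp z f c\<phi>)
  have dW: "(W has_real_derivative - g (\<phi> \<xi>)) (at \<xi>)" if E: "\<xi> \<notin> E" for \<xi>
  proof -
    consider "\<phi> \<xi> = 0" | "\<phi> \<xi> = 1" | "\<phi> \<xi> \<in> {0<..<1} - {\<alpha>, \<gamma>}" using E_cases[OF E] by blast
    then show ?thesis
    proof cases
      case 1
      have "eventually (\<lambda>\<xi>'. W \<xi>' = W \<xi>) (nhds \<xi>)"
        using flat0[OF 1 E] by eventually_elim (simp add: W_def 1)
      then show ?thesis using DERIV_cong_ev[OF refl _ refl, of W "\<lambda>_. W \<xi>" \<xi> 0] 1 g by simp
    next
      case 2
      have "eventually (\<lambda>\<xi>'. W \<xi>' = W \<xi>) (nhds \<xi>)"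
        using flat1[OF 2 E] by eventually_elim (simp add: W_def 2)
      then show ?thesis using DERIV_cong_ev[OF refl _ refl, of W "\<lambda>_. W \<xi>" \<xi> 0] 2 g by simp
    next
      case 3
      let ?x = "\<phi> \<xi>"
      have x: "?x \<in> {0<..<1}" "?x \<in> {0<..<1} - {\<alpha>}" using 3 by auto
      have "(W has_real_derivative
          (f' ?x - c - D ?x * g ?x / z ?x) * (z ?x / D ?x) - f' ?x * (z ?x / D ?x) + c * (z ?x / D ?x)) (at \<xi>)"
        unfolding W_def[abs_def]
        by (intro DERIV_add DERIV_diff DERIV_cmult DERIV_chain2[where f = z and g = \<phi>, OF dz[OF 3]]
            DERIV_chain2[where f = f and g = \<phi>, OF f(2)[OF x(1)]]
            d\<phi>[OF x(2)])
      also have "(f' ?x - c - D ?x * g ?x / z ?x) * (z ?x / D ?x) - f' ?x * (z ?x / D ?x) + c * (z ?x / D ?x)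
          = - g ?x"
        using DzX[OF x(2)] by (simp add: field_simps)
      finally show ?thesis .
    qed
  qed
  have weak: "(LINT \<xi>|lborel. (D (\<phi> \<xi>) * \<phi>' \<xi> - f (\<phi> \<xi>) + c * \<phi> \<xi>) * deriv \<psi> \<xi> - g (\<phi> \<xi>) * \<psi> \<xi>) = 0"
    if test: "test_fun \<psi>" for \<psi>
  proof -
    have dif: "((deriv ^^ n) \<psi>) differentiable (at x)" for n x
      using test by (auto simp: test_fun_def)
    have d\<psi>: "(\<psi> has_real_derivative deriv \<psi> x) (at x)" for x
      using dif[of 0 x] by (simp add: DERIV_deriv_iff_real_differentiable)
    have c\<psi>: "continuous_on UNIV \<psi>"
      by (intro continuous_at_imp_continuous_on ballI DERIV_isCont[OF d\<psi>])
    have cd\<psi>: "continuous_on UNIV (deriv \<psi>)"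
      using dif[of 1] by (intro continuous_at_imp_continuous_on ballI differentiable_imp_continuous_within) simp
    obtain R0 where R0: "\<And>x. \<psi> x \<noteq> 0 \<Longrightarrow> norm x \<le> R0"
      using test unfolding test_fun_def bounded_iff by blast
    \<comment> \<open>The added 1 puts the points R and -R strictly outside the support bound, so
      that the boundary terms vanish.\<close>
    define R where "R = max 1 R0 + 1"
    have R: "0 < R" "\<And>x. R \<le> \<bar>x\<bar> \<Longrightarrow> \<psi> x = 0" using R0 by (force simp: R_def)+
    have out: "deriv \<psi> x = 0 \<and> \<psi> x = 0" if "x \<notin> {-R..R}" for x
    proof -
      have x: "R < \<bar>x\<bar>" using that by auto
      have "eventually (\<lambda>y. \<psi> y = 0) (nhds x)"
        unfolding eventually_nhds_metric
      proof (intro exI conjI allI impI)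
        show "0 < \<bar>x\<bar> - R" using x by simp
        fix y assume "dist y x < \<bar>x\<bar> - R"
        then show "\<psi> y = 0" by (intro R) (auto simp: dist_real_def)
      qed
      then show ?thesis
        using DERIV_cong_ev[OF refl _ refl, of \<psi> "\<lambda>_. 0" x 0] R(2)[of x] x
        by (auto intro: DERIV_imp_deriv)
    qed
    define I where "I \<xi> = W \<xi> * deriv \<psi> \<xi> - g (\<phi> \<xi>) * \<psi> \<xi>" for \<xi>
    have cI: "continuous_on UNIV I"
      unfolding I_def by (intro continuous_intros cW cd\<psi> c\<psi> comp g)
    have "(I has_integral W R * \<psi> R - W (- R) * \<psi> (- R)) {-R..R}"
    proof (rule fundamental_theorem_of_calculus_interior_strong[OF finE])
      fix x assume "x \<in> {-R<..<R} - E"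
      then have "((\<lambda>x. W x * \<psi> x) has_real_derivative I x) (at x)"
        using DERIV_mult[OF dW d\<psi>, of x] by (simp add: I_def algebra_simps)
      then show "((\<lambda>x. W x * \<psi> x) has_vector_derivative I x) (at x)"
        by (simp add: has_real_derivative_iff_has_vector_derivative)
    qed (use R in \<open>auto intro!: continuous_intros continuous_on_subset[OF cW] continuous_on_subset[OF c\<psi>]\<close>)
    then have int0: "integral {-R..R} I = 0" using R by (simp add: integral_unique)
    have "set_integrable lborel {-R..R} I"
      by (rule borel_integrable_atLeastAtMost') (auto intro: continuous_on_subset[OF cI])
    then have "(LINT x:{-R..R}|lborel. I x) = 0"
      using set_borel_integral_eq_integral(2)[of "{-R..R}" I] int0 by simp
    moreover have "(\<lambda>x. indicator {-R..R} x *\<^sub>R I x) = I"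
    proof
      fix x show "indicator {-R..R} x *\<^sub>R I x = I x"
        using out[of x] by (cases "x \<in> {-R..R}") (simp_all add: I_def)
    qed
    ultimately have "(LINT x|lborel. I x) = 0" by (simp only: set_lebesgue_integral_def)
    moreover have "(D (\<phi> x) * \<phi>' x - f (\<phi> x) + c * \<phi> x) * deriv \<psi> x - g (\<phi> x) * \<psi> x = I x" for x
      by (simp only: flux I_def W_def)
    ultimately show ?thesis by simp
  qed
  have tw: "traveling_wave f D g c \<phi>"
    unfolding traveling_wave_def
  proof (intro conjI exI[of _ \<phi>'] allI impI)
    show "AE \<xi> in lborel. (\<phi> has_real_derivative \<phi>' \<xi>) (at \<xi>)"
      by (rule AE_I'[of E]) (use finE d\<phi>' in \<open>auto intro: finite_imp_null_set_lborel\<close>)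
    fix a b :: real
    show "set_integrable lborel {a..b} (\<lambda>\<xi>. D (\<phi> \<xi>) * \<phi>' \<xi>)"
      unfolding flux
      by (rule borel_integrable_atLeastAtMost') (rule continuous_on_subset[OF comp[OF z(1)]], simp)
  qed (use c\<phi> range weak in auto)
  have "\<phi> (X \<alpha>) = \<alpha>" by (rule inv) (use \<alpha> in simp)
  moreover have "\<phi> (X (\<alpha> / 2)) = \<alpha> / 2" by (rule inv) (use \<alpha> in simp)
  ultimately have "\<phi> (X \<alpha>) \<noteq> \<phi> (X (\<alpha> / 2))" using \<alpha> by linarith
  then have "wavefront f D g c \<phi>"
    unfolding wavefront_def by (intro conjI tw anti bot top exI)
  then show ?thesis by blast
qed

section \<open>Integrability of the density D / z at the crossing of \<alpha>\<close>

text \<open>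
  A nonnegative density \<open>k\<close> with \<open>L (b - x)\<^sup>\<tau> k \<le> M \<plusminus> u'\<close> is integrable up to \<open>b\<close>: after division by the
  weight, the term \<open>\<plusminus> u' (b - x)\<^sup>-\<^sup>\<tau>\<close> is integrated by parts, and \<open>u = O(b - x)\<close> controls what remains.
  For \<open>\<tau> = 0\<close> boundedness of \<open>u\<close> suffices.
\<close>
lemma crossing_antiderivative:
  fixes k u :: "real \<Rightarrow> real"
  assumes x0: "a \<le> x0" "x0 < b"
    and k: "\<And>x. x \<in> {a<..<b} \<Longrightarrow> isCont k x" "\<And>x. x \<in> {a<..<b} \<Longrightarrow> 0 \<le> k x"
    and s: "s = 1 \<or> s = - 1" and \<tau>: "0 \<le> \<tau>" "\<tau> < 1" and L: "0 < L"
    and du: "\<And>x. x \<in> {x0<..<b} \<Longrightarrow> (u has_real_derivative du x) (at x)"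
    and kle: "\<And>x. x \<in> {x0<..<b} \<Longrightarrow> L * (b - x) powr \<tau> * k x \<le> M + s * du x"
    and u: "\<And>x. x \<in> {x0<..<b} \<Longrightarrow> 0 \<le> u x"
      "\<And>x. x \<in> {x0<..<b} \<Longrightarrow> \<tau> * u x \<le> K * (b - x)"
      "\<And>x. x \<in> {x0<..<b} \<Longrightarrow> u x \<le> K * (b - x) powr \<tau>"
    and M: "0 \<le> M"
  shows "\<exists>F l. (\<forall>x\<in>{a<..<b}. (F has_real_derivative k x) (at x)) \<and> (F \<longlongrightarrow> l) (at_left b)"
proof -
  have "\<exists>F. \<forall>x. ereal a < ereal x \<longrightarrow> ereal x < ereal b \<longrightarrow> (F has_vector_derivative k x) (at x)"
    by (rule einterval_antiderivative) (use x0 k(1) in auto)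
  then obtain F where F: "\<And>x. x \<in> {a<..<b} \<Longrightarrow> (F has_real_derivative k x) (at x)"
    by (auto simp: has_real_derivative_iff_has_vector_derivative)
  have mono: "F x \<le> F y" if "a < x" "x \<le> y" "y < b" for x y
  proof (rule DERIV_nonneg_imp_nondecreasing[OF that(2)])
    fix t assume "x \<le> t" "t \<le> y"
    then have "t \<in> {a<..<b}" using that by auto
    then show "\<exists>d. (F has_real_derivative d) (at t) \<and> 0 \<le> d" using F k(2) by blast
  qed
  have K: "0 \<le> K"
  proof -
    have "(x0 + b) / 2 \<in> {x0<..<b}" using x0 by auto
    from order_trans[OF u(1,3)[OF this]] show ?thesis
      using x0 by (simp add: zero_le_mult_iff)
  qed
  \<comment> \<open>G is built to grow at least as fast as an antiderivative F of k while staying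
    bounded above. Its last term has derivative \<open>(M + K) * (b - x) powr (- \<tau>)\<close>
    before division by L: M pays for the bounded part of the estimate for k, and K for
    \<open>\<tau> * u / (b - x)\<close>, which arises when the weight is differentiated. Then F is
    monotone and bounded, hence convergent at b; \<tau> < 1 makes the power
    \<open>1 - \<tau>\<close> positive.\<close>
  define G where "G x = (s * (u x * (b - x) powr (- \<tau>)) - (M + K) / (1 - \<tau>) * (b - x) powr (1 - \<tau>)) / L" for x
  define dG where "dG x = (s * (du x * (b - x) powr (- \<tau>) + u x * (\<tau> * (b - x) powr (- \<tau> - 1)))
      + (M + K) * (b - x) powr (- \<tau>)) / L" for x
  have G: "(G has_real_derivative dG x) (at x)" if x: "x \<in> {x0<..<b}" for x
  proof -
    have p: "((\<lambda>x. (b - x) powr r) has_real_derivative - r * (b - x) powr (r - 1)) (at x)" for r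
      using x by (auto intro!: derivative_eq_intros simp: powr_diff field_simps)
    have e: "(1 - \<tau>) - 1 = - \<tau>" by simp
    have "(G has_real_derivative (s * (du x * (b - x) powr (- \<tau>)
        + - (- \<tau>) * (b - x) powr (- \<tau> - 1) * u x)
        - (M + K) / (1 - \<tau>) * (- (1 - \<tau>) * (b - x) powr (- \<tau>))) / L) (at x)"
      unfolding G_def[abs_def]
      by (intro DERIV_cdivide DERIV_diff DERIV_cmult DERIV_mult du[OF x] p p[of "1 - \<tau>", unfolded e])
    moreover have "(M + K) / (1 - \<tau>) * (- (1 - \<tau>) * (b - x) powr (- \<tau>)) = - ((M + K) * (b - x) powr (- \<tau>))"
    proof -
      have "(M + K) / (1 - \<tau>) * (1 - \<tau>) = M + K" using \<tau> by simp
      then show ?thesis by (metis minus_mult_left minus_mult_right mult.assoc)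
    qed
    ultimately show ?thesis by (simp add: dG_def mult.commute)
  qed
  have kdG: "k x \<le> dG x" if x: "x \<in> {x0<..<b}" for x
  proof -
    define w where "w = (b - x) powr (- \<tau>)"
    have bx: "0 < b - x" using x by simp
    have w: "0 < w" "w * (b - x) powr \<tau> = 1"
      using bx by (auto simp: w_def powr_minus field_simps)
    have "(b - x) powr (- \<tau> - 1) = w / (b - x)" using bx by (simp add: w_def powr_diff)
    then have dG: "L * dG x = s * (du x * w) + s * (\<tau> * u x / (b - x) * w) + (M + K) * w"
      using L bx by (simp add: dG_def w_def field_simps)
    have q: "0 \<le> \<tau> * u x / (b - x)" "\<tau> * u x / (b - x) \<le> K"
      using u(1,2)[OF x] \<tau> bx by (auto simp: pos_divide_le_eq)
    have "- K \<le> s * (\<tau> * u x / (b - x))" using s q K by auto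
    then have "- K * w \<le> s * (\<tau> * u x / (b - x)) * w" using w by (intro mult_right_mono) auto
    then have "(M + s * du x) * w \<le> L * dG x" unfolding dG by (simp add: algebra_simps)
    moreover have "L * k x = L * (b - x) powr \<tau> * k x * w" using w by (simp add: mult.commute)
    moreover have "L * (b - x) powr \<tau> * k x * w \<le> (M + s * du x) * w"
      using kle[OF x] w by (intro mult_right_mono) auto
    ultimately have "L * k x \<le> L * dG x" by linarith
    then show ?thesis using L by simp
  qed
  have Gub: "G x \<le> K / L" if x: "x \<in> {x0<..<b}" for x
  proof -
    have bx: "0 < b - x" using x by simp
    have w: "0 < (b - x) powr (- \<tau>)" "(b - x) powr \<tau> * (b - x) powr (- \<tau>) = 1"
      using bx by (auto simp: powr_minus field_simps)
    have "u x * (b - x) powr (- \<tau>) \<le> K * (b - x) powr \<tau> * (b - x) powr (- \<tau>)"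
      using u(3)[OF x] w by (intro mult_right_mono) auto
    then have "u x * (b - x) powr (- \<tau>) \<le> K" using w by (simp add: mult.assoc)
    moreover have "0 \<le> u x * (b - x) powr (- \<tau>)" using u(1)[OF x] by simp
    ultimately have "s * (u x * (b - x) powr (- \<tau>)) \<le> K" using s K by auto
    moreover have "0 \<le> (M + K) / (1 - \<tau>) * (b - x) powr (1 - \<tau>)" using M K \<tau> by simp
    ultimately show ?thesis unfolding G_def using L by (intro divide_right_mono) auto
  qed
  define y where "y = (x0 + b) / 2"
  have y: "x0 < y" "y < b" using x0 by (auto simp: y_def)
  have bound: "F x \<le> K / L + (F y - G y)" if "y \<le> x" "x < b" for x
  proof -
    have "F x - G x \<le> F y - G y"
    proof (rule DERIV_nonpos_imp_nonincreasing[of y x "\<lambda>x. F x - G x"])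
      fix t assume "y \<le> t" "t \<le> x"
      then have t: "t \<in> {x0<..<b}" "t \<in> {a<..<b}" using that y x0 by auto
      show "\<exists>d. ((\<lambda>x. F x - G x) has_real_derivative d) (at t) \<and> d \<le> 0"
        using kdG[OF t(1)] by (intro exI[of _ "k t - dG t"] conjI DERIV_diff F G t) auto
    qed (use that in auto)
    then show ?thesis using Gub[of x] that y by auto
  qed
  have "(F \<longlongrightarrow> Sup (F ` ({..<b} \<inter> {y..}))) (at b within ({..<b} \<inter> {y..}))"
    by (rule Lim_left_bound[where K = "K / L + (F y - G y)"]) (use mono bound y x0 in auto)
  moreover have "at b within ({..<b} \<inter> {y..}) = at_left b"
    by (rule at_within_nhd[of b "{y<..}"]) (use y in auto)
  ultimately have "(F \<longlongrightarrow> Sup (F ` ({..<b} \<inter> {y..}))) (at_left b)" by simp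
  then show ?thesis using F by blast
qed

lemma isCont_interior_01:
  assumes "continuous_on {0..1} h" "x \<in> {0<..<1}"
  shows "isCont (h :: real \<Rightarrow> real) x"
proof -
  have "continuous_on {0<..<1} h" by (rule continuous_on_subset[OF assms(1)]) auto
  then show ?thesis using assms(2) by (simp add: continuous_on_eq_continuous_at)
qed

text \<open>The equation turns g times the density \<open>- D / z\<close> into
  \<open>z' - (f' - c)\<close>, and the signs \<open>sl\<close>, \<open>sr\<close> of g beside
  \<alpha> make the left side positive. The factor \<tau> in the first bound on z lets one statement
  serve two situations: for \<tau> = 0 only boundedness of z remains, for \<tau> > 0 linear decay at
  \<alpha> is demanded.\<close>

lemma wavefront_of_crossing_flux:
  fixes f D g z :: "real \<Rightarrow> real"
  assumes \<alpha>: "0 < \<alpha>" "\<alpha> < 1" and \<gamma>: "0 < \<gamma>" "\<gamma> < 1"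
    and f: "continuous_on {0..1} f" "\<And>x. x \<in> {0<..<1} \<Longrightarrow> (f has_real_derivative f' x) (at x)"
      "\<And>x. x \<in> {0<..<1} \<Longrightarrow> \<bar>f' x - c\<bar> \<le> M"
    and D: "continuous_on {0..1} D" "\<And>x. x \<in> {0<..<\<alpha>} \<Longrightarrow> 0 < D x" "\<And>x. x \<in> {\<alpha><..<1} \<Longrightarrow> D x < 0"
    and g: "continuous_on {0..1} g" "g 0 = 0" "g 1 = 0"
    and z: "continuous_on {0..1} z" "z 0 = 0" "z \<alpha> = 0" "z 1 = 0"
      "\<And>x. x \<in> {0<..<\<alpha>} \<Longrightarrow> z x < 0" "\<And>x. x \<in> {\<alpha><..<1} \<Longrightarrow> 0 < z x"
    and dz: "\<And>x. x \<in> {0<..<1} - {\<alpha>, \<gamma>} \<Longrightarrow>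
      (z has_real_derivative f' x - c - D x * g x / z x) (at x)"
    and sl: "sl = 1 \<or> sl = - 1" and sr: "sr = 1 \<or> sr = - 1"
    and \<tau>: "0 \<le> \<tau>" "\<tau> < 1" and L: "0 < L" and e: "0 < e"
    and gl: "\<And>x. x \<in> {0<..<\<alpha>} \<Longrightarrow> \<alpha> - e < x \<Longrightarrow> L * (\<alpha> - x) powr \<tau> \<le> sl * g x"
    and gr: "\<And>x. x \<in> {\<alpha><..<1} \<Longrightarrow> x < \<alpha> + e \<Longrightarrow> L * (x - \<alpha>) powr \<tau> \<le> sr * g x"
    and zt: "\<And>x. x \<in> {0<..<1} - {\<alpha>} \<Longrightarrow> \<tau> * \<bar>z x\<bar> \<le> K * \<bar>x - \<alpha>\<bar>"
      "\<And>x. x \<in> {0<..<1} - {\<alpha>} \<Longrightarrow> \<bar>z x\<bar> \<le> K * \<bar>x - \<alpha>\<bar> powr \<tau>"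
  shows "\<exists>\<phi>. wavefront f D g c \<phi>"
proof -
  have M0: "0 \<le> M" using f(3)[of \<alpha>] \<alpha> by auto
  have z_ne: "z x \<noteq> 0" if "x \<in> {0<..<1} - {\<alpha>}" for x
    using z(5)[of x] z(6)[of x] that by (cases "x < \<alpha>") auto
  \<comment> \<open>Shrinks the neighborhood of \<alpha> so that \<gamma>, where z may lack a
    derivative, lies outside unless it coincides with \<alpha>.\<close>
  define d where "d = (if \<gamma> = \<alpha> then e else min e \<bar>\<gamma> - \<alpha>\<bar>)"
  have d: "0 < d" "d \<le> e" "\<And>x. 0 < \<bar>x - \<alpha>\<bar> \<Longrightarrow> \<bar>x - \<alpha>\<bar> < d \<Longrightarrow> x \<noteq> \<gamma>"
    using e by (auto simp: d_def split: if_splits)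
  have "\<exists>F l. (\<forall>x\<in>{0<..<\<alpha>}. (F has_real_derivative D x / - z x) (at x)) \<and> (F \<longlongrightarrow> l) (at_left \<alpha>)"
  proof (rule crossing_antiderivative[where ?x0.0 = "max 0 (\<alpha> - d)" and s = "- sl" and u = "\<lambda>x. - z x"
        and du = "\<lambda>x. - (f' x - c - D x * g x / z x)" and M = M and K = K and \<tau> = \<tau> and L = L])
    fix x assume x: "x \<in> {0<..<\<alpha>}"
    then have x': "x \<in> {0<..<1}" "x \<in> {0<..<1} - {\<alpha>}" using \<alpha> by auto
    show "isCont (\<lambda>x. D x / - z x) x"
      using z_ne[OF x'(2)] by (intro continuous_intros isCont_interior_01[OF D(1) x'(1)] isCont_interior_01[OF z(1) x'(1)]) auto
    show "0 \<le> D x / - z x" using D(2)[OF x] z(5)[OF x] by (intro divide_nonneg_nonneg) auto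
  next
    fix x assume x: "x \<in> {max 0 (\<alpha> - d)<..<\<alpha>}"
    then have x': "x \<in> {0<..<\<alpha>}" "x \<in> {0<..<1}" "x \<in> {0<..<1} - {\<alpha>}" "x \<in> {0<..<1} - {\<alpha>, \<gamma>}"
      "\<alpha> - e < x"
      using \<alpha> d(2) d(3)[of x] by auto
    show "((\<lambda>x. - z x) has_real_derivative - (f' x - c - D x * g x / z x)) (at x)"
      by (rule DERIV_minus[OF dz[OF x'(4)]])
    have k: "0 \<le> D x / - z x" using D(2)[OF x'(1)] z(5)[OF x'(1)] by (intro divide_nonneg_nonneg) auto
    have "L * (\<alpha> - x) powr \<tau> * (D x / - z x) \<le> sl * g x * (D x / - z x)"
      by (rule mult_right_mono[OF gl[OF x'(1,5)] k])
    also have "\<dots> = - sl * (D x * g x / z x)" using z_ne[OF x'(3)] by (simp add: field_simps)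
    also have "\<dots> \<le> M + - sl * - (f' x - c - D x * g x / z x)"
      using f(3)[OF x'(2)] sl by auto
    finally show "L * (\<alpha> - x) powr \<tau> * (D x / - z x) \<le> M + - sl * - (f' x - c - D x * g x / z x)" .
    show "0 \<le> - z x" using z(5)[OF x'(1)] by simp
    show "\<tau> * - z x \<le> K * (\<alpha> - x)" "- z x \<le> K * (\<alpha> - x) powr \<tau>"
      using zt[OF x'(3)] z(5)[OF x'(1)] x' by auto
  qed (use \<alpha> d \<tau> L sl M0 in auto)
  then obtain F1 l1 where F1: "\<And>x. x \<in> {0<..<\<alpha>} \<Longrightarrow> (F1 has_real_derivative D x / - z x) (at x)"
    and l1: "(F1 \<longlongrightarrow> l1) (at_left \<alpha>)"
    by blast
  \<comment> \<open>Reflection moves the right neighborhood of \<alpha> to the left of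
    \<open>- \<alpha>\<close>, where the one-sided lemma applies.\<close>
  have "\<exists>F l. (\<forall>x\<in>{- 1<..<- \<alpha>}. (F has_real_derivative D (- x) / - z (- x)) (at x)) \<and> (F \<longlongrightarrow> l) (at_left (- \<alpha>))"
  proof (rule crossing_antiderivative[where ?x0.0 = "max (- 1) (- \<alpha> - d)" and s = "- sr" and u = "\<lambda>x. z (- x)"
        and du = "\<lambda>x. - (f' (- x) - c - D (- x) * g (- x) / z (- x))" and M = M and K = K and \<tau> = \<tau> and L = L])
    fix x assume x: "x \<in> {- 1<..<- \<alpha>}"
    then have x': "- x \<in> {0<..<1}" "- x \<in> {0<..<1} - {\<alpha>}" "- x \<in> {\<alpha><..<1}" using \<alpha> by auto
    have "isCont (\<lambda>x. h (- x)) x" if "continuous_on {0..1} h" for h :: "real \<Rightarrow> real"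
      by (rule isCont_o2[where g = h]) (use isCont_interior_01[OF that x'(1)] in \<open>auto intro!: continuous_intros\<close>)
    then show "isCont (\<lambda>x. D (- x) / - z (- x)) x"
      using z_ne[OF x'(2)] D z by (intro continuous_intros) auto
    show "0 \<le> D (- x) / - z (- x)" using D(3)[OF x'(3)] z(6)[OF x'(3)] by (intro divide_nonpos_nonpos) auto
  next
    fix x assume x: "x \<in> {max (- 1) (- \<alpha> - d)<..<- \<alpha>}"
    then have x': "- x \<in> {\<alpha><..<1}" "- x \<in> {0<..<1}" "- x \<in> {0<..<1} - {\<alpha>}" "- x \<in> {0<..<1} - {\<alpha>, \<gamma>}"
      "- x < \<alpha> + e"
      using \<alpha> d(2) d(3)[of "- x"] by auto
    show "((\<lambda>x. z (- x)) has_real_derivative - (f' (- x) - c - D (- x) * g (- x) / z (- x))) (at x)"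
      using dz[OF x'(4)] by (simp add: DERIV_mirror)
    have k: "0 \<le> D (- x) / - z (- x)"
      using D(3)[OF x'(1)] z(6)[OF x'(1)] by (intro divide_nonpos_nonpos) auto
    have "L * (- \<alpha> - x) powr \<tau> * (D (- x) / - z (- x)) = L * (- x - \<alpha>) powr \<tau> * (D (- x) / - z (- x))"
      by (simp add: minus_diff_commute)
    also have "\<dots> \<le> sr * g (- x) * (D (- x) / - z (- x))"
      by (rule mult_right_mono[OF gr[OF x'(1,5)] k])
    also have "\<dots> = - sr * (D (- x) * g (- x) / z (- x))" using z_ne[OF x'(3)] by (simp add: field_simps)
    also have "\<dots> \<le> M + - sr * - (f' (- x) - c - D (- x) * g (- x) / z (- x))"
      using f(3)[OF x'(2)] sr by auto
    finally show "L * (- \<alpha> - x) powr \<tau> * (D (- x) / - z (- x)) \<le> M + - sr * - (f' (- x) - c - D (- x) * g (- x) / z (- x))" .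
    show "0 \<le> z (- x)" using z(6)[OF x'(1)] by simp
    show "\<tau> * z (- x) \<le> K * (- \<alpha> - x)" "z (- x) \<le> K * (- \<alpha> - x) powr \<tau>"
      using zt[OF x'(3)] z(6)[OF x'(1)] x' by (auto simp: minus_diff_commute)
  qed (use \<alpha> d \<tau> L sr M0 in auto)
  then obtain F2 l2 where F2: "\<And>x. x \<in> {- 1<..<- \<alpha>} \<Longrightarrow> (F2 has_real_derivative D (- x) / - z (- x)) (at x)"
    and l2: "(F2 \<longlongrightarrow> l2) (at_left (- \<alpha>))"
    by blast
  \<comment> \<open>Subtracting the one-sided limits makes both branches tend to 0 at \<alpha>; this
    is the continuity of X through the degenerate level.\<close>
  define X where "X x = (if x < \<alpha> then l1 - F1 x else if x = \<alpha> then 0 else F2 (- x) - l2)" for x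
  have dX: "(X has_real_derivative D x / z x) (at x)" if x: "x \<in> {0<..<1} - {\<alpha>}" for x
  proof (cases "x < \<alpha>")
    case True
    have ev: "eventually (\<lambda>y. X y = l1 - F1 y) (nhds x)"
      using eventually_nhds_in_open[of "{..<\<alpha>}" x] True by (auto simp: X_def elim: eventually_mono)
    have "((\<lambda>y. l1 - F1 y) has_real_derivative 0 - D x / - z x) (at x)"
      by (intro DERIV_diff DERIV_const F1) (use x True in auto)
    then show ?thesis using DERIV_cong_ev[OF refl ev refl] by simp
  next
    case False
    then have "\<alpha> < x" using x by simp
    then have ev: "eventually (\<lambda>y. X y = F2 (- y) - l2) (nhds x)"
      using eventually_nhds_in_open[of "{\<alpha><..}" x] by (auto simp: X_def elim: eventually_mono)
    have "(F2 has_real_derivative D x / - z x) (at (- x))" using F2[of "- x"] x \<open>\<alpha> < x\<close> by simp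
    then have "((\<lambda>y. F2 (- y)) has_real_derivative - (D x / - z x)) (at x)"
      by (simp add: DERIV_mirror)
    then have "((\<lambda>y. F2 (- y) - l2) has_real_derivative - (D x / - z x) - 0) (at x)"
      by (intro DERIV_diff DERIV_const)
    then show ?thesis using DERIV_cong_ev[OF refl ev refl] by simp
  qed
  have "isCont X \<alpha>"
    unfolding isCont_def
  proof (rule filterlim_split_at)
    have "((\<lambda>x. l1 - F1 x) \<longlongrightarrow> l1 - l1) (at_left \<alpha>)" by (intro tendsto_intros l1)
    then have "((\<lambda>x. l1 - F1 x) \<longlongrightarrow> X \<alpha>) (at_left \<alpha>)" by (simp add: X_def)
    then show "(X \<longlongrightarrow> X \<alpha>) (at_left \<alpha>)"
      by (rule Lim_transform_eventually) (auto simp: X_def eventually_at_filter)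
    have "((\<lambda>x. F2 (- x)) \<longlongrightarrow> l2) (at_right \<alpha>)"
      using l2 by (simp add: at_right_minus[of \<alpha>] filterlim_filtermap)
    then have "((\<lambda>x. F2 (- x) - l2) \<longlongrightarrow> l2 - l2) (at_right \<alpha>)" by (intro tendsto_intros)
    then have "((\<lambda>x. F2 (- x) - l2) \<longlongrightarrow> X \<alpha>) (at_right \<alpha>)" by (simp add: X_def)
    then show "(X \<longlongrightarrow> X \<alpha>) (at_right \<alpha>)"
      by (rule Lim_transform_eventually) (auto simp: X_def eventually_at_filter)
  qed
  then have "isCont X x" if "x \<in> {0<..<1}" for x
    using DERIV_isCont[OF dX, of x] that by (cases "x = \<alpha>") auto
  then have cX: "continuous_on {0<..<1} X" by (intro continuous_at_imp_continuous_on) auto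
  show ?thesis
  proof (rule wavefront_of_flux[OF \<alpha> \<gamma> f(1,2) g z(1-4) _ dz cX dX])
    fix x assume "x \<in> {0<..<1} - {\<alpha>}"
    then show "D x * z x < 0"
      using D(2,3)[of x] z(5,6)[of x] by (cases "x < \<alpha>") (auto simp: mult_less_0_iff)
  qed auto
qed

section \<open>Concave convection\<close>

lemma continuous_on_glue:
  fixes u v :: "real \<Rightarrow> real"
  assumes "continuous_on {a..b} u" "continuous_on {b..c} v" "u b = v b"
  shows "continuous_on {a..c} (\<lambda>x. if x \<le> b then u x else v x)"
  by (rule continuous_on_cases_le)
    (use assms in \<open>auto intro!: continuous_intros intro: continuous_on_subset\<close>)

locale degenerate_rde =
  fixes f D g f' D' :: "real \<Rightarrow> real" and \<alpha> \<gamma> :: real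
  assumes \<alpha>: "0 < \<alpha>" "\<alpha> < 1" and \<gamma>: "0 < \<gamma>" "\<gamma> < 1"
    and f: "C1_on_01 f f'" and D: "C1_on_01 D D'"
    and D_pos: "\<And>x. x \<in> {0<..<\<alpha>} \<Longrightarrow> 0 < D x" and D_neg: "\<And>x. x \<in> {\<alpha><..<1} \<Longrightarrow> D x < 0"
    and cont_g: "continuous_on {0..1} g"
    and g_neg: "\<And>x. x \<in> {0<..<\<gamma>} \<Longrightarrow> g x < 0" and g_pos: "\<And>x. x \<in> {\<gamma><..<1} \<Longrightarrow> 0 < g x"
    and g_zero: "g 0 = 0" "g \<gamma> = 0" "g 1 = 0"
    and concave: "strictly_concave_on {0..1} f"
begin

definition q :: "real \<Rightarrow> real" where "q x = D x * g x"

lemma deriv_f: "x \<in> {0<..<1} \<Longrightarrow> (f has_real_derivative f' x) (at x)"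
  using f by (auto simp: C1_on_01_def at_within_Icc_at dest!: bspec[of _ _ x])

lemma deriv_D: "x \<in> {0<..<1} \<Longrightarrow> (D has_real_derivative D' x) (at x)"
  using D by (auto simp: C1_on_01_def at_within_Icc_at dest!: bspec[of _ _ x])

lemma cont_f: "continuous_on {0..1} f"
  using f by (auto simp: C1_on_01_def intro: DERIV_continuous_on)

lemma cont_D: "continuous_on {0..1} D"
  using D by (auto simp: C1_on_01_def intro: DERIV_continuous_on)

lemma cont_f': "continuous_on {0..1} f'"
  using f by (simp add: C1_on_01_def)

lemma cont_q: "continuous_on {0..1} q"
  unfolding q_def by (intro continuous_intros cont_D cont_g)

lemma cont_subset:
  assumes "continuous_on {0..1} h" "0 \<le> a" "b \<le> 1"
  shows "continuous_on {a..b} (h :: real \<Rightarrow> real)"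
  by (rule continuous_on_subset[OF assms(1)]) (use assms in auto)

lemma cont_reflect:
  assumes "continuous_on {0..1} h" "- 1 \<le> a" "b \<le> 0"
  shows "continuous_on {a..b} (\<lambda>x. h (- x :: real) :: real)"
  by (rule continuous_on_compose2[OF assms(1)]) (use assms in \<open>auto intro!: continuous_intros\<close>)

lemma bounded_on_01:
  assumes "continuous_on {0..1} (h :: real \<Rightarrow> real)"
  obtains B where "0 \<le> B" "\<And>x. x \<in> {0..1} \<Longrightarrow> \<bar>h x\<bar> \<le> B"
proof -
  obtain B where B: "\<And>x. x \<in> {0..1} \<Longrightarrow> norm (h x) \<le> B"
    using compact_imp_bounded[OF compact_continuous_image[OF assms]] unfolding bounded_iff by blast
  have "norm (h 0) \<le> B" by (rule B) simp
  then have "0 \<le> B" using norm_ge_zero order_trans by blast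
  then show ?thesis using B by (intro that[of B]) auto
qed

section \<open>Secant inequalities for concave f and signs of q\<close>

text \<open>The slope inequality for adjacent secants in division-free form, so that the estimates
  below only have to cancel one positive factor.\<close>

lemma chord:
  assumes "0 \<le> x" "x < y" "y < w" "w \<le> 1"
  shows "(f w - f y) * (y - x) \<le> (f y - f x) * (w - y)"
proof -
  define t where "t = (y - x) / (w - x)"
  have t: "0 < t" "t < 1" "t * (w - x) = y - x" using assms by (auto simp: t_def)
  have y: "(1 - t) * x + t * w = y" using t(3) by (simp add: algebra_simps)
  have "(1 - t) * f x + t * f w < f ((1 - t) * x + t * w)"
    using concave t(1,2) assms unfolding strictly_concave_on_def by auto
  then have "(w - x) * ((1 - t) * f x + t * f w) \<le> (w - x) * f y"
    unfolding y using assms by (intro mult_left_mono) auto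
  moreover have "(w - x) * ((1 - t) * f x + t * f w) = (w - y) * f x + (y - x) * f w"
  proof -
    have "(w - x) * ((1 - t) * f x + t * f w) = (w - x) * f x + (t * (w - x)) * (f w - f x)"
      by (simp add: algebra_simps)
    also have "\<dots> = (w - y) * f x + (y - x) * f w" unfolding t(3) by (simp add: algebra_simps)
    finally show ?thesis .
  qed
  ultimately show ?thesis by (simp add: algebra_simps)
qed

lemma tangent_at_\<gamma>:
  assumes "x \<in> {0..1}"
  shows "f x - f \<gamma> \<le> f' \<gamma> * (x - \<gamma>)"
proof -
  have "- f x - - f \<gamma> \<ge> - f' \<gamma> * (x - \<gamma>)"
  proof (rule convex_on_imp_above_tangent[of "{0..1}" "\<lambda>x. - f x"])
    show "convex_on {0..1} (\<lambda>x. - f x)"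
    proof (rule convex_onI)
      fix t x y :: real assume t: "0 < t" "t < 1" and xy: "x \<in> {0..1}" "y \<in> {0..1}"
      show "- f ((1 - t) *\<^sub>R x + t *\<^sub>R y) \<le> (1 - t) * - f x + t * - f y"
      proof (cases "x = y")
        case True
        then show ?thesis by (simp add: algebra_simps)
      next
        case False
        then have "(1 - t) * f x + t * f y < f ((1 - t) * x + t * y)"
          using concave t xy unfolding strictly_concave_on_def by blast
        then show ?thesis by simp
      qed
    qed simp
    show "((\<lambda>x. - f x) has_real_derivative - f' \<gamma>) (at \<gamma> within {0..1})"
      using f \<gamma> by (intro DERIV_minus) (auto simp: C1_on_01_def)
  qed (use assms \<gamma> in auto)
  then show ?thesis by simp
qed

text \<open>The secant from x to y is at least as steep as the one from y to \<gamma>, and that one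
  at least as steep as the tangent at \<gamma>. Hence \<open>f' \<gamma>\<close> bounds the speed
  from above in every arrival to the left of \<gamma>.\<close>

lemma slope_left_of_\<gamma>:
  assumes "0 \<le> x" "x \<le> y" "y \<le> \<gamma>"
  shows "f' \<gamma> * (y - x) \<le> f y - f x"
proof (cases "x = y \<or> y = \<gamma>")
  case True
  then show ?thesis using tangent_at_\<gamma>[of x] assms \<gamma> by (auto simp: algebra_simps)
next
  case False
  then have xy: "x < y" "y < \<gamma>" using assms by auto
  have "f' \<gamma> * (\<gamma> - y) \<le> f \<gamma> - f y"
    using tangent_at_\<gamma>[of y] assms xy \<gamma> by (auto simp: algebra_simps)
  then have "f' \<gamma> * (\<gamma> - y) * (y - x) \<le> (f \<gamma> - f y) * (y - x)"
    using xy by (intro mult_right_mono) auto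
  also have "\<dots> \<le> (f y - f x) * (\<gamma> - y)" using chord[of x y \<gamma>] assms xy \<gamma> by auto
  finally have "(f' \<gamma> * (y - x)) * (\<gamma> - y) \<le> (f y - f x) * (\<gamma> - y)" by (simp add: algebra_simps)
  then show ?thesis using xy by simp
qed

text \<open>Secants ending at 1 lose slope as their left end moves right, so the first one, from x0,
  is the worst. This is the origin of the quotient subtracted in the hypotheses.\<close>

lemma slope_to_1:
  assumes "0 \<le> x0" "x0 \<le> x" "x < 1"
  shows "f 1 - f x \<le> (f 1 - f x0) / (1 - x0) * (1 - x)"
proof (cases "x = x0")
  case False
  then have "(f 1 - f x) * (x - x0) \<le> (f x - f x0) * (1 - x)" using chord[of x0 x 1] assms by auto
  then have "(f 1 - f x) * (1 - x0) \<le> (f 1 - f x0) * (1 - x)" by (simp add: algebra_simps)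
  then show ?thesis using assms by (simp add: pos_le_divide_eq)
qed (use assms in simp)

lemma q_zero: "q 0 = 0" "q \<gamma> = 0" "q 1 = 0"
  by (simp_all add: q_def g_zero)

lemma D_\<alpha>: "D \<alpha> = 0"
proof -
  have "(D \<longlongrightarrow> D \<alpha>) (at \<alpha>)" using isCont_interior_01[OF cont_D, of \<alpha>] \<alpha> by (simp add: isCont_def)
  then have l: "(D \<longlongrightarrow> D \<alpha>) (at_left \<alpha>)" and r: "(D \<longlongrightarrow> D \<alpha>) (at_right \<alpha>)"
    by (auto simp: filterlim_at_split)
  have "eventually (\<lambda>x. 0 \<le> D x) (at_left \<alpha>)"
    using \<alpha> D_pos by (auto simp: eventually_at_left_field less_imp_le intro!: exI[of _ 0])
  then have "0 \<le> D \<alpha>" by (rule tendsto_lowerbound[OF l]) simp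
  moreover have "eventually (\<lambda>x. D x \<le> 0) (at_right \<alpha>)"
    using \<alpha> D_neg by (auto simp: eventually_at_right_field less_imp_le intro!: exI[of _ 1])
  then have "D \<alpha> \<le> 0" by (rule tendsto_upperbound[OF r]) simp
  ultimately show ?thesis by simp
qed

lemma q_\<alpha>: "q \<alpha> = 0"
  by (simp add: q_def D_\<alpha>)

lemma q_neg_left: "0 < x \<Longrightarrow> x < \<alpha> \<Longrightarrow> x < \<gamma> \<Longrightarrow> q x < 0"
  using D_pos[of x] g_neg[of x] by (simp add: q_def mult_pos_neg)

lemma q_neg_right: "\<alpha> < x \<Longrightarrow> \<gamma> < x \<Longrightarrow> x < 1 \<Longrightarrow> q x < 0"
  using D_neg[of x] g_pos[of x] by (simp add: q_def mult_neg_pos)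

lemma q_pos_middle: "\<gamma> < x \<and> x < \<alpha> \<or> \<alpha> < x \<and> x < \<gamma> \<Longrightarrow> 0 < q x"
  using D_neg[of x] g_neg[of x] D_pos[of x] g_pos[of x] \<alpha> \<gamma>
  by (auto simp: q_def intro: mult_neg_neg)

section \<open>Outer pieces of the flux\<close>

text \<open>A speed above the secant slope by \<open>2 * sqrt S\<close> makes
  \<open>f x - c * x\<close> decrease towards 1 fast enough for landing. The initial value is left
  free below the barrier: it is 0 when the piece starts at \<alpha> and positive when it starts at
  \<gamma> > \<alpha>.\<close>

lemma rightmost_piece:
  assumes x0: "\<alpha> \<le> x0" "\<gamma> \<le> x0" "x0 < 1" and S: "0 < S"
    and qS: "\<And>x. x \<in> {x0<..<1} \<Longrightarrow> - q x \<le> S * (1 - x)"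
    and c: "(f 1 - f x0) / (1 - x0) + 2 * sqrt S \<le> c"
    and \<eta>: "0 \<le> \<eta>" "\<eta> \<le> sqrt S * (1 - x0)"
  shows "\<exists>y. positive_sol (\<lambda>t. f' t - c) (\<lambda>t. - q t) x0 1 y \<and> y x0 = \<eta> \<and> y 1 = 0"
proof -
  have q: "- q x > 0" if "x \<in> {x0<..<1}" for x using q_neg_right[of x] that x0 by auto
  have "\<exists>y. positive_sol (\<lambda>t. f' t - c) (\<lambda>t. - q t) x0 1 y \<and> y x0 = \<eta>"
  proof (rule positive_sol_exists)
    fix t assume t: "t \<in> {x0..1}"
    have "q x0 \<le> 0" using q_neg_right[of x0] q_zero q_\<alpha> x0 by (cases "\<alpha> = x0 \<or> \<gamma> = x0") auto
    then show "0 \<le> - q t" using q[of t] q_zero t by (cases "t = x0 \<or> t = 1") auto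
  qed (use x0 q \<alpha> \<eta> in \<open>auto intro!: continuous_intros cont_subset cont_f' cont_q\<close>)
  then obtain y where y: "positive_sol (\<lambda>t. f' t - c) (\<lambda>t. - q t) x0 1 y" "y x0 = \<eta>" by blast
  have "y 1 = 0"
  proof (rule positive_sol_landing[OF y(1) x0(3) _ S, where F = "\<lambda>x. f x - c * x"])
    show "continuous_on {x0..1} (\<lambda>x. f x - c * x)"
      using x0 \<alpha> by (intro continuous_intros cont_subset[OF cont_f]) auto
    fix t assume t: "t \<in> {x0<..<1}"
    show "((\<lambda>x. f x - c * x) has_real_derivative f' t - c) (at t)"
      using t x0 \<alpha> by (auto intro!: derivative_eq_intros deriv_f)
  next
    fix t assume t: "t \<in> {x0..<1}"
    have "((f 1 - f x0) / (1 - x0) + 2 * sqrt S) * (1 - t) \<le> c * (1 - t)"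
      using c t by (intro mult_right_mono) auto
    then show "f 1 - c * 1 - (f t - c * t) \<le> - 2 * sqrt S * (1 - t)"
      using slope_to_1[of x0 t] t x0 \<alpha> by (auto simp: algebra_simps)
  qed (use q qS \<eta> y in \<open>auto simp: less_imp_le\<close>)
  then show ?thesis using y by blast
qed

text \<open>Here small speeds help, since A is \<open>c - f'\<close>. With x1 = \<alpha> this
  supplies the zero at \<alpha>; with x1 = \<gamma> < \<alpha> it shows that the speed bound is a
  lower bracket for the matching speed.\<close>

lemma leftmost_piece_landing:
  assumes x1: "0 < x1" "x1 \<le> \<alpha>" "x1 \<le> \<gamma>" and S: "0 < S"
    and qS: "\<And>x. x \<in> {0<..<x1} \<Longrightarrow> - q x \<le> S * (x1 - x)"
    and c: "c \<le> f' \<gamma> - 2 * sqrt S"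
    and y: "positive_sol (\<lambda>t. c - f' t) (\<lambda>t. - q t) 0 x1 y" "y 0 = 0"
  shows "y x1 = 0"
proof (rule positive_sol_landing[OF y(1) x1(1) _ S, where F = "\<lambda>x. c * x - f x"])
  show "continuous_on {0..x1} (\<lambda>x. c * x - f x)"
    using x1 \<alpha> by (intro continuous_intros cont_subset[OF cont_f]) auto
  fix t assume t: "t \<in> {0<..<x1}"
  show "((\<lambda>x. c * x - f x) has_real_derivative c - f' t) (at t)"
    using t x1 \<alpha> by (auto intro!: derivative_eq_intros deriv_f)
  show "0 \<le> - q t" using q_neg_left[of t] t x1 by auto
next
  fix t assume t: "t \<in> {0..<x1}"
  have "c * (x1 - t) \<le> (f' \<gamma> - 2 * sqrt S) * (x1 - t)" using c t by (intro mult_right_mono) auto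
  then show "c * x1 - f x1 - (c * t - f t) \<le> - 2 * sqrt S * (x1 - t)"
    using slope_left_of_\<gamma>[of t x1] t x1 by (auto simp: algebra_simps)
qed (use qS y S x1 in auto)

lemma leftmost_piece_exists:
  assumes x1: "0 < x1" "x1 \<le> \<alpha>" "x1 \<le> \<gamma>"
  shows "\<exists>y. positive_sol (\<lambda>t. c - f' t) (\<lambda>t. - q t) 0 x1 y \<and> y 0 = 0"
proof (rule positive_sol_exists)
  have q: "0 < - q t" if "t \<in> {0<..<x1}" for t using q_neg_left[of t] that x1 by auto
  then show "0 < - q t" if "t \<in> {0<..<x1}" for t using that by simp
  fix t assume t: "t \<in> {0..x1}"
  have "q x1 \<le> 0" using q_neg_left[of x1] q_zero q_\<alpha> x1 by (cases "\<alpha> = x1 \<or> \<gamma> = x1") auto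
  then show "0 \<le> - q t" using q[of t] q_zero t by (cases "t = 0 \<or> t = x1") auto
qed (use x1 \<alpha> in \<open>auto intro!: continuous_intros cont_subset cont_f' cont_q\<close>)

text \<open>The two parts correspond to the two forms of the source P: \<open>- q\<close> when the
  arrival point is approached from the left, \<open>q\<close> when it is approached from the
  right.\<close>

lemma dq_Sup_bound:
  assumes bdd: "bdd_above ((\<lambda>x. dq (\<lambda>x. D x * g x) p x) ` A)" and p: "q p = 0"
  defines "S \<equiv> Sup ((\<lambda>x. dq (\<lambda>x. D x * g x) p x) ` A)"
  shows "x \<in> A \<Longrightarrow> x < p \<Longrightarrow> - q x \<le> S * (p - x)"
    and "x \<in> A \<Longrightarrow> p < x \<Longrightarrow> q x \<le> S * (x - p)"
proof -
  assume x: "x \<in> A"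
  have S: "dq q p x \<le> S" unfolding S_def
    using bdd x by (intro cSup_upper) (auto simp: q_def[abs_def])
  {
    assume "x < p"
    then have "- q x / (p - x) \<le> S" using p S unfolding dq_def by (simp add: field_simps)
    then show "- q x \<le> S * (p - x)" using \<open>x < p\<close> by (simp only: pos_divide_le_eq diff_gt_0_iff_gt)
  next
    assume "p < x"
    then show "q x \<le> S * (x - p)" using S p unfolding dq_def by (simp add: pos_divide_le_eq)
  }
qed

text \<open>If g does not vanish at \<alpha>, it keeps its sign and at least half its size near
  \<alpha>. The crossing criterion then applies with exponent 0 and asks no more of z than
  boundedness.\<close>

lemma wavefront_of_bounded_flux:
  assumes g\<alpha>: "g \<alpha> \<noteq> 0"
    and z: "continuous_on {0..1} z" "z 0 = 0" "z \<alpha> = 0" "z 1 = 0"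
      "\<And>x. x \<in> {0<..<\<alpha>} \<Longrightarrow> z x < 0" "\<And>x. x \<in> {\<alpha><..<1} \<Longrightarrow> 0 < z x"
    and dz: "\<And>x. x \<in> {0<..<1} - {\<alpha>, \<gamma>} \<Longrightarrow> (z has_real_derivative f' x - c - q x / z x) (at x)"
  shows "\<exists>\<phi>. wavefront f D g c \<phi>"
proof -
  have "continuous_on {0..1} (\<lambda>x. f' x - c)" by (intro continuous_intros cont_f')
  then obtain M where M: "\<And>x. x \<in> {0..1} \<Longrightarrow> \<bar>f' x - c\<bar> \<le> M" by (rule bounded_on_01) blast
  obtain K where K: "0 \<le> K" "\<And>x. x \<in> {0..1} \<Longrightarrow> \<bar>z x\<bar> \<le> K" by (rule bounded_on_01[OF z(1)]) blast
  define s where "s = sgn (g \<alpha>)"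
  have s: "s = 1 \<or> s = - 1" "0 < s * g \<alpha>" using g\<alpha> by (auto simp: s_def sgn_if mult_neg_neg)
  have "((\<lambda>x. s * g x) \<longlongrightarrow> s * g \<alpha>) (at \<alpha>)"
    using isCont_interior_01[OF cont_g, of \<alpha>] \<alpha> by (intro tendsto_intros) (auto simp: isCont_def)
  then have "eventually (\<lambda>x. s * g \<alpha> / 2 < s * g x) (at \<alpha>)"
    using s by (intro order_tendstoD(1)) auto
  then obtain e where e: "0 < e" "\<And>x. x \<noteq> \<alpha> \<Longrightarrow> dist x \<alpha> < e \<Longrightarrow> s * g \<alpha> / 2 < s * g x"
    unfolding eventually_at by blast
  show ?thesis
  proof (rule wavefront_of_crossing_flux[where z = z and \<tau> = 0 and L = "s * g \<alpha> / 2" and K = K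
        and M = M and e = e and sl = s and sr = s and \<alpha> = \<alpha> and \<gamma> = \<gamma> and f' = f'])
    fix x assume "x \<in> {0<..<\<alpha>}" "\<alpha> - e < x"
    then show "s * g \<alpha> / 2 * (\<alpha> - x) powr 0 \<le> s * g x" using e(2)[of x] by (simp add: dist_real_def)
  next
    fix x assume "x \<in> {\<alpha><..<1}" "x < \<alpha> + e"
    then show "s * g \<alpha> / 2 * (x - \<alpha>) powr 0 \<le> s * g x" using e(2)[of x] by (simp add: dist_real_def)
  qed (use \<alpha> \<gamma> cont_f deriv_f M cont_D D_pos D_neg cont_g g_zero z dz s e K in \<open>auto simp: q_def\<close>)
qed

section \<open>The three relative positions of \<alpha> and \<gamma>\<close>

text \<open>The point \<gamma> is a source from which one solution runs left to \<alpha> and one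
  runs right to 1, while a third comes from 0 to \<alpha>. The three arrivals only confine c to an
  interval, which the gap condition makes nonempty.\<close>

lemma wavefront_case_c:
  assumes lt: "\<alpha> < \<gamma>"
    and b1: "bdd_above ((\<lambda>\<phi>. dq (\<lambda>x. D x * g x) 1 \<phi>) ` {\<gamma>..<1})"
    and b2: "bdd_above ((\<lambda>\<phi>. dq (\<lambda>x. D x * g x) \<alpha> \<phi>) ` ({0..\<gamma>} - {\<alpha>}))"
    and gap: "f' \<gamma> - (f 1 - f \<gamma>) / (1 - \<gamma>) \<ge>
            2 * (sqrt (Sup ((\<lambda>\<phi>. dq (\<lambda>x. D x * g x) 1 \<phi>) ` {\<gamma>..<1}))
               + sqrt (Sup ((\<lambda>\<phi>. dq (\<lambda>x. D x * g x) \<alpha> \<phi>) ` ({0..\<gamma>} - {\<alpha>}))))"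
  shows "\<exists>c \<phi>. wavefront f D g c \<phi>"
proof -
  define S1 where "S1 = Sup ((\<lambda>\<phi>. dq (\<lambda>x. D x * g x) 1 \<phi>) ` {\<gamma>..<1})"
  define S2 where "S2 = Sup ((\<lambda>\<phi>. dq (\<lambda>x. D x * g x) \<alpha> \<phi>) ` ({0..\<gamma>} - {\<alpha>}))"
  have q1: "- q x \<le> S1 * (1 - x)" if "x \<in> {\<gamma><..<1}" for x
    unfolding S1_def by (rule dq_Sup_bound(1)[OF b1]) (use that q_zero in auto)
  have q2: "- q x \<le> S2 * (\<alpha> - x)" if "x \<in> {0<..<\<alpha>}" for x
    unfolding S2_def by (rule dq_Sup_bound(1)[OF b2]) (use that q_\<alpha> lt in auto)
  have q3: "q x \<le> S2 * (x - \<alpha>)" if "x \<in> {\<alpha><..\<gamma>}" for x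
    unfolding S2_def by (rule dq_Sup_bound(2)[OF b2]) (use that q_\<alpha> \<alpha> in auto)
  \<comment> \<open>The sign of q at a midpoint forces the supremum to be positive, so that the
    barriers are not degenerate.\<close>
  have "0 < S1 * (1 - (\<gamma> + 1) / 2)"
    by (rule less_le_trans[OF _ q1]) (use q_neg_right[of "(\<gamma> + 1) / 2"] \<gamma> lt in auto)
  then have S1: "0 < S1" by (rule zero_less_mult_pos2) (use \<gamma> in simp)
  have "0 < S2 * (\<alpha> - \<alpha> / 2)"
    by (rule less_le_trans[OF _ q2]) (use q_neg_left[of "\<alpha> / 2"] \<alpha> lt in auto)
  then have S2: "0 < S2" by (rule zero_less_mult_pos2) (use \<alpha> in simp)
  define c where "c = f' \<gamma> - 2 * sqrt S2"
  have c: "(f 1 - f \<gamma>) / (1 - \<gamma>) + 2 * sqrt S1 \<le> c" using gap unfolding c_def S1_def S2_def by simp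
  \<comment> \<open>The common value of the flux at \<gamma>. It has to be positive because z > 0 on
    all of (\<alpha>, 1), and small enough to start below both barriers.\<close>
  define \<eta> where "\<eta> = min (sqrt S1 * (1 - \<gamma>)) (sqrt S2 * (\<gamma> - \<alpha>))"
  have \<eta>: "0 < \<eta>" "\<eta> \<le> sqrt S1 * (1 - \<gamma>)" "\<eta> \<le> sqrt S2 * (\<gamma> - \<alpha>)"
    using S1 S2 lt \<gamma> by (auto simp: \<eta>_def)
  obtain y1 where y1: "positive_sol (\<lambda>t. c - f' t) (\<lambda>t. - q t) 0 \<alpha> y1" "y1 0 = 0"
    using leftmost_piece_exists[of \<alpha> c] \<alpha> lt by auto
  have y1\<alpha>: "y1 \<alpha> = 0"
    by (rule leftmost_piece_landing[OF _ _ _ S2 q2 _ y1]) (use \<alpha> lt in \<open>auto simp: c_def\<close>)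
  obtain y3 where y3: "positive_sol (\<lambda>t. f' t - c) (\<lambda>t. - q t) \<gamma> 1 y3" "y3 \<gamma> = \<eta>" "y3 1 = 0"
    using rightmost_piece[OF _ _ _ S1 q1 c, of \<eta>] \<eta> lt \<gamma> by auto
  \<comment> \<open>Here q > 0, so z has a positive source only when followed from \<gamma> down to
    \<alpha>.\<close>
  have "\<exists>y. positive_sol (\<lambda>t. c - f' (- t)) (\<lambda>t. q (- t)) (- \<gamma>) (- \<alpha>) y \<and> y (- \<gamma>) = \<eta>"
  proof (rule positive_sol_exists)
    show pos: "0 < q (- t)" if "t \<in> {- \<gamma><..<- \<alpha>}" for t
      using q_pos_middle[of "- t"] that by auto
    show "0 \<le> q (- t)" if "t \<in> {- \<gamma>..- \<alpha>}" for t
      using pos[of t] that q_zero q_\<alpha> by (cases "t = - \<gamma> \<or> t = - \<alpha>") auto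
  qed (use lt \<alpha> \<gamma> \<eta> in \<open>auto intro!: continuous_intros cont_reflect[OF cont_f'] cont_reflect[OF cont_q]\<close>)
  then obtain y2 where y2: "positive_sol (\<lambda>t. c - f' (- t)) (\<lambda>t. q (- t)) (- \<gamma>) (- \<alpha>) y2" "y2 (- \<gamma>) = \<eta>"
    by blast
  have y2\<alpha>: "y2 (- \<alpha>) = 0"
  proof (rule positive_sol_landing[OF y2(1) _ _ S2, where F = "\<lambda>t. c * t + f (- t)"])
    show "continuous_on {- \<gamma>..- \<alpha>} (\<lambda>t. c * t + f (- t))"
      using \<alpha> \<gamma> by (intro continuous_intros cont_reflect[OF cont_f]) auto
    fix t assume t: "t \<in> {- \<gamma><..<- \<alpha>}"
    have "(f has_real_derivative f' (- t)) (at (- t))" using t \<alpha> \<gamma> by (intro deriv_f) auto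
    then have "((\<lambda>t. f (- t)) has_real_derivative - f' (- t)) (at t)" by (simp add: DERIV_mirror)
    then show "((\<lambda>t. c * t + f (- t)) has_real_derivative c - f' (- t)) (at t)"
      by (auto intro!: derivative_eq_intros)
    show "0 \<le> q (- t)" using q_pos_middle[of "- t"] t by auto
    show "q (- t) \<le> S2 * (- \<alpha> - t)" using q3[of "- t"] t by (simp add: minus_diff_commute)
  next
    fix t assume t: "t \<in> {- \<gamma>..<- \<alpha>}"
    have "f' \<gamma> * (- t - \<alpha>) \<le> f (- t) - f \<alpha>" using slope_left_of_\<gamma>[of \<alpha> "- t"] t \<alpha> by auto
    then show "c * - \<alpha> + f (- (- \<alpha>)) - (c * t + f (- t)) \<le> - 2 * sqrt S2 * (- \<alpha> - t)"
      by (simp add: c_def algebra_simps)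
  qed (use lt \<eta> y2 in auto)
  define z where "z x = (if x \<le> \<alpha> then - y1 x else if x \<le> \<gamma> then y2 (- x) else y3 x)" for x
  have cy: "continuous_on {0..\<alpha>} y1" "continuous_on {- \<gamma>..- \<alpha>} y2" "continuous_on {\<gamma>..1} y3"
    using y1 y2 y3 by (auto simp: positive_sol_def)
  have py: "x \<in> {0<..<\<alpha>} \<Longrightarrow> 0 < y1 x" "- x \<in> {- \<gamma><..<- \<alpha>} \<Longrightarrow> 0 < y2 (- x)" "x \<in> {\<gamma><..<1} \<Longrightarrow> 0 < y3 x" for x
    using y1 y2 y3 unfolding positive_sol_def by blast+
  have "\<exists>\<phi>. wavefront f D g c \<phi>"
  proof (rule wavefront_of_bounded_flux)
    show "g \<alpha> \<noteq> 0" using g_neg[of \<alpha>] \<alpha> lt by simp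
    have "continuous_on {\<alpha>..\<gamma>} (\<lambda>x. y2 (- x))"
      by (rule continuous_on_compose2[OF cy(2)]) (auto intro!: continuous_intros)
    then have rest: "continuous_on {\<alpha>..1} (\<lambda>x. if x \<le> \<gamma> then y2 (- x) else y3 x)"
      by (rule continuous_on_glue) (use cy y2 y3 in auto)
    show "continuous_on {0..1} z"
      unfolding z_def using cy y1\<alpha> y2\<alpha> lt
      by (intro continuous_on_glue[OF _ rest]) (auto intro!: continuous_intros)
    show "z 0 = 0" "z \<alpha> = 0" "z 1 = 0" using y1 y1\<alpha> y3 \<alpha> \<gamma> by (auto simp: z_def)
    show "z x < 0" if "x \<in> {0<..<\<alpha>}" for x using py(1)[of x] that by (simp add: z_def)
    show "0 < z x" if "x \<in> {\<alpha><..<1}" for x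
      using py(2,3)[of x] that y2(2) \<eta> by (cases x \<gamma> rule: linorder_cases) (auto simp: z_def)
    fix x assume x: "x \<in> {0<..<1} - {\<alpha>, \<gamma>}"
    consider "x \<in> {0<..<\<alpha>}" | "x \<in> {\<alpha><..<\<gamma>}" | "x \<in> {\<gamma><..<1}" using x by fastforce
    then show "(z has_real_derivative f' x - c - q x / z x) (at x)"
    proof cases
      case 1
      have "((\<lambda>t. - y1 t) has_real_derivative f' x - c - q x / z x) (at x)"
        using positive_sol_minus_deriv[OF y1(1) 1] 1 by (simp add: z_def)
      then show ?thesis
        by (rule has_field_derivative_transform_within_open[where S = "{0<..<\<alpha>}"]) (use 1 in \<open>auto simp: z_def\<close>)
    next
      case 2
      have "((\<lambda>t. y2 (- t)) has_real_derivative f' x - c - q x / z x) (at x)"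
        using positive_sol_reflect_deriv[OF y2(1), of x] 2 by (simp add: z_def)
      then show ?thesis
        by (rule has_field_derivative_transform_within_open[where S = "{\<alpha><..<\<gamma>}"]) (use 2 in \<open>auto simp: z_def\<close>)
    next
      case 3
      have "(y3 has_real_derivative f' x - c - q x / z x) (at x)"
        using y3(1) 3 lt by (auto simp: z_def positive_sol_def)
      then show ?thesis
        by (rule has_field_derivative_transform_within_open[where S = "{\<gamma><..<1}"]) (use 3 lt in \<open>auto simp: z_def\<close>)
    qed
  qed
  then show ?thesis by blast
qed

text \<open>Since g vanishes at the crossing level, boundedness of z no longer suffices. The extra
  work is a linear bound on z at \<alpha>, which meets the demands of the crossing criterion for
  positive \<tau>.\<close>

lemma wavefront_case_b:
  assumes eq: "\<alpha> = \<gamma>"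
    and b1: "bdd_above ((\<lambda>\<phi>. dq (\<lambda>x. D x * g x) 1 \<phi>) ` {\<alpha>..<1})"
    and b2: "bdd_above ((\<lambda>\<phi>. dq (\<lambda>x. D x * g x) \<gamma> \<phi>) ` {0..<\<gamma>})"
    and gap: "f' \<gamma> - (f 1 - f \<alpha>) / (1 - \<alpha>) \<ge>
            2 * (sqrt (Sup ((\<lambda>\<phi>. dq (\<lambda>x. D x * g x) 1 \<phi>) ` {\<alpha>..<1}))
               + sqrt (Sup ((\<lambda>\<phi>. dq (\<lambda>x. D x * g x) \<gamma> \<phi>) ` {0..<\<gamma>})))"
    and growth: "0 < L" "0 < \<tau>" "\<tau> < 1" "0 < e"
      "\<And>x. \<bar>x - \<gamma>\<bar> < e \<Longrightarrow> L * \<bar>x - \<gamma>\<bar> powr \<tau> \<le> \<bar>g x\<bar>"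
  shows "\<exists>c \<phi>. wavefront f D g c \<phi>"
proof -
  define S1 where "S1 = Sup ((\<lambda>\<phi>. dq (\<lambda>x. D x * g x) 1 \<phi>) ` {\<alpha>..<1})"
  define S2 where "S2 = Sup ((\<lambda>\<phi>. dq (\<lambda>x. D x * g x) \<gamma> \<phi>) ` {0..<\<gamma>})"
  have q1: "- q x \<le> S1 * (1 - x)" if "x \<in> {\<alpha><..<1}" for x
    unfolding S1_def by (rule dq_Sup_bound(1)[OF b1]) (use that q_zero in auto)
  have q2: "- q x \<le> S2 * (\<alpha> - x)" if "x \<in> {0<..<\<alpha>}" for x
    unfolding S2_def eq by (rule dq_Sup_bound(1)[OF b2]) (use that q_zero eq in auto)
  have "0 < S1 * (1 - (\<alpha> + 1) / 2)"
    by (rule less_le_trans[OF _ q1]) (use q_neg_right[of "(\<alpha> + 1) / 2"] \<alpha> eq in auto)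
  then have S1: "0 < S1" by (rule zero_less_mult_pos2) (use \<alpha> in simp)
  have "0 < S2 * (\<alpha> - \<alpha> / 2)"
    by (rule less_le_trans[OF _ q2]) (use q_neg_left[of "\<alpha> / 2"] \<alpha> eq in auto)
  then have S2: "0 < S2" by (rule zero_less_mult_pos2) (use \<alpha> in simp)
  define c where "c = f' \<gamma> - 2 * sqrt S2"
  have c: "(f 1 - f \<alpha>) / (1 - \<alpha>) + 2 * sqrt S1 \<le> c" using gap unfolding c_def S1_def S2_def by simp
  obtain y1 where y1: "positive_sol (\<lambda>t. c - f' t) (\<lambda>t. - q t) 0 \<alpha> y1" "y1 0 = 0"
    using leftmost_piece_exists[of \<alpha> c] \<alpha> eq by auto
  have y1\<alpha>: "y1 \<alpha> = 0"
    by (rule leftmost_piece_landing[OF _ _ _ S2 q2 _ y1]) (use \<alpha> eq in \<open>auto simp: c_def\<close>)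
  obtain y3 where y3: "positive_sol (\<lambda>t. f' t - c) (\<lambda>t. - q t) \<alpha> 1 y3" "y3 \<alpha> = 0" "y3 1 = 0"
    using rightmost_piece[OF _ _ _ S1 q1 c, of 0] eq \<alpha> S1 by auto
  have cy: "continuous_on {0..\<alpha>} y1" "continuous_on {\<alpha>..1} y3"
    using y1 y3 by (auto simp: positive_sol_def)
  have py: "x \<in> {0<..<\<alpha>} \<Longrightarrow> 0 < y1 x" "x \<in> {\<alpha><..<1} \<Longrightarrow> 0 < y3 x" for x
    using y1 y3 unfolding positive_sol_def by blast+
  have "continuous_on {0..1} (\<lambda>x. f' x - c)" by (intro continuous_intros cont_f')
  then obtain M where M: "0 \<le> M" "\<And>x. x \<in> {0..1} \<Longrightarrow> \<bar>f' x - c\<bar> \<le> M" by (rule bounded_on_01) blast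
  obtain B where B: "0 \<le> B" "\<And>x. x \<in> {0..1} \<Longrightarrow> \<bar>D' x\<bar> \<le> B"
    using D unfolding C1_on_01_def by (elim conjE bounded_on_01) blast
  obtain G where G: "0 \<le> G" "\<And>x. x \<in> {0..1} \<Longrightarrow> \<bar>g x\<bar> \<le> G" by (rule bounded_on_01[OF cont_g]) blast
  \<comment> \<open>K is chosen so that lines of slope K are barriers on both sides:
    \<open>M \<le> K\<close> suffices on the left, and on the right a line of slope K meets a source
    of at most \<open>B * G / K\<close>.\<close>
  define K where "K = M + B * G + 1"
  have K: "1 \<le> K" "M \<le> K" "M + B * G / K \<le> K"
  proof -
    have "0 \<le> B * G" using B G by simp
    then show 1: "1 \<le> K" "M \<le> K" using M by (auto simp: K_def)
    have "B * G / K \<le> B * G / 1" using \<open>0 \<le> B * G\<close> 1 by (intro divide_left_mono) auto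
    then show "M + B * G / K \<le> K" by (simp add: K_def)
  qed
  \<comment> \<open>D vanishes at \<alpha> and has bounded derivative, hence q is at most linear
    there although g is only continuous.\<close>
  have qB: "- q x \<le> B * G * (x - \<alpha>)" if x: "x \<in> {\<alpha><..<1}" for x
  proof -
    have "\<exists>t>\<alpha>. t < x \<and> D x - D \<alpha> = (x - \<alpha>) * D' t"
      by (rule MVT2) (use x \<alpha> in \<open>auto intro: deriv_D\<close>)
    then obtain t where t: "\<alpha> < t" "t < x" "D x = (x - \<alpha>) * D' t" using D_\<alpha> by auto
    have "\<bar>D x\<bar> \<le> (x - \<alpha>) * B" unfolding t(3) using B(2)[of t] t x \<alpha> by (simp add: abs_mult)
    then have "\<bar>D x\<bar> * \<bar>g x\<bar> \<le> (x - \<alpha>) * B * G"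
      using G(2)[of x] x \<alpha> B by (intro mult_mono) auto
    moreover have "- q x \<le> \<bar>D x\<bar> * \<bar>g x\<bar>" by (simp add: q_def abs_mult[symmetric])
    ultimately show ?thesis by (simp add: mult_ac)
  qed
  \<comment> \<open>The source can only raise y1, so y1 falls at rate at most K; as it has to reach
    0 at \<alpha>, it lies below the line of slope -K through that point.\<close>
  have y1K: "y1 x \<le> K * (\<alpha> - x)" if x: "x \<in> {0<..<\<alpha>}" for x
  proof -
    have "y1 x + K * x \<le> y1 \<alpha> + K * \<alpha>"
    proof (rule DERIV_nonneg_imp_increasing_open[of x \<alpha> "\<lambda>x. y1 x + K * x"])
      fix t assume "x < t" "t < \<alpha>"
      then have t: "t \<in> {0<..<\<alpha>}" using x by auto
      have "0 \<le> - q t / y1 t"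
        using q_neg_left[of t] py(1)[OF t] t eq by (intro divide_nonneg_nonneg) auto
      then have "0 \<le> c - f' t + - q t / y1 t + K" using M(2)[of t] K t \<alpha> by auto
      moreover have "((\<lambda>x. y1 x + K * x) has_real_derivative (c - f' t + - q t / y1 t) + K) (at t)"
        using y1(1) t unfolding positive_sol_def by (auto intro!: derivative_eq_intros)
      ultimately show "\<exists>d. ((\<lambda>x. y1 x + K * x) has_real_derivative d) (at t) \<and> 0 \<le> d" by blast
    qed (use x in \<open>auto intro!: continuous_intros continuous_on_subset[OF cy(1)]\<close>)
    then show ?thesis using y1\<alpha> by (simp add: algebra_simps)
  qed
  have y3K: "y3 x \<le> K * (x - \<alpha>)" if x: "x \<in> {\<alpha><..<1}" for x
  proof (rule positive_sol_le_supersolution[OF y3(1)])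
    fix t assume t: "t \<in> {\<alpha><..<1}"
    show "0 \<le> - q t" using q_neg_right[of t] t eq by auto
    have "- q t / (K * (t - \<alpha>)) \<le> B * G * (t - \<alpha>) / (K * (t - \<alpha>))"
      using qB[OF t] K t by (intro divide_right_mono) auto
    also have "\<dots> = B * G / K" using t by simp
    finally have "f' t - c + - q t / (K * (t - \<alpha>)) \<le> K" using M(2)[of t] K t \<alpha> by auto
    moreover have "((\<lambda>t. K * (t - \<alpha>)) has_real_derivative K) (at t)" by (auto intro!: derivative_eq_intros)
    ultimately show "0 < K * (t - \<alpha>) \<and> (\<exists>d. ((\<lambda>t. K * (t - \<alpha>)) has_real_derivative d) (at t)
        \<and> f' t - c + - q t / (K * (t - \<alpha>)) \<le> d)"
      using K t by auto
  qed (use x y3 in \<open>auto intro!: continuous_intros\<close>)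
  define z where "z x = (if x \<le> \<alpha> then - y1 x else y3 x)" for x
  have zK: "\<bar>z x\<bar> \<le> K * \<bar>x - \<alpha>\<bar>" if "x \<in> {0<..<1} - {\<alpha>}" for x
    using y1K[of x] y3K[of x] py[of x] that by (cases "x < \<alpha>") (auto simp: z_def)
  have "\<exists>\<phi>. wavefront f D g c \<phi>"
  proof (rule wavefront_of_crossing_flux[where z = z and \<tau> = \<tau> and L = L and K = K
        and M = M and e = e and sl = "- 1" and sr = 1 and \<alpha> = \<alpha> and \<gamma> = \<gamma> and f' = f'])
    show "continuous_on {0..1} z"
      unfolding z_def using cy y1\<alpha> y3(2) by (intro continuous_on_glue) (auto intro!: continuous_intros)
    show "z 0 = 0" "z \<alpha> = 0" "z 1 = 0" using y1 y1\<alpha> y3 \<alpha> by (auto simp: z_def)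
    show "z x < 0" if "x \<in> {0<..<\<alpha>}" for x using py(1)[of x] that by (simp add: z_def)
    show "0 < z x" if "x \<in> {\<alpha><..<1}" for x using py(2)[of x] that by (simp add: z_def)
    fix x assume x: "x \<in> {0<..<1} - {\<alpha>, \<gamma>}"
    consider "x \<in> {0<..<\<alpha>}" | "x \<in> {\<alpha><..<1}" using x by fastforce
    then show "(z has_real_derivative f' x - c - D x * g x / z x) (at x)"
    proof cases
      case 1
      have "((\<lambda>t. - y1 t) has_real_derivative f' x - c - D x * g x / z x) (at x)"
        using positive_sol_minus_deriv[OF y1(1) 1] 1 by (simp add: z_def q_def)
      then show ?thesis
        by (rule has_field_derivative_transform_within_open[where S = "{0<..<\<alpha>}"]) (use 1 in \<open>auto simp: z_def\<close>)
    next
      case 2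
      have "(y3 has_real_derivative f' x - c - D x * g x / z x) (at x)"
        using y3(1) 2 by (auto simp: z_def q_def positive_sol_def)
      then show ?thesis
        by (rule has_field_derivative_transform_within_open[where S = "{\<alpha><..<1}"]) (use 2 in \<open>auto simp: z_def\<close>)
    qed
  next
    fix x assume x: "x \<in> {0<..<\<alpha>}" "\<alpha> - e < x"
    then show "L * (\<alpha> - x) powr \<tau> \<le> - 1 * g x"
      using growth(5)[of x] g_neg[of x] eq by auto
  next
    fix x assume x: "x \<in> {\<alpha><..<1}" "x < \<alpha> + e"
    then show "L * (x - \<alpha>) powr \<tau> \<le> 1 * g x"
      using growth(5)[of x] g_pos[of x] eq by auto
  next
    fix x assume x: "x \<in> {0<..<1} - {\<alpha>}"
    have "\<tau> * \<bar>z x\<bar> \<le> 1 * \<bar>z x\<bar>" using growth by (intro mult_right_mono) auto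
    then show "\<tau> * \<bar>z x\<bar> \<le> K * \<bar>x - \<alpha>\<bar>" using zK[OF x] by simp
    \<comment> \<open>Distances are at most 1 here, so the smaller exponent \<tau> gives the larger
      power and the linear bound implies the second requirement.\<close>
    have "\<bar>x - \<alpha>\<bar> powr 1 \<le> \<bar>x - \<alpha>\<bar> powr \<tau>" using x \<alpha> growth by (intro powr_mono') auto
    then have "K * \<bar>x - \<alpha>\<bar> \<le> K * \<bar>x - \<alpha>\<bar> powr \<tau>" using K by (intro mult_left_mono) auto
    then show "\<bar>z x\<bar> \<le> K * \<bar>x - \<alpha>\<bar> powr \<tau>" using zK[OF x] by linarith
  qed (use \<alpha> \<gamma> cont_f deriv_f M cont_D D_pos D_neg cont_g g_zero growth in auto)
  then show ?thesis by blast
qed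

text \<open>
  The solutions leaving 0 and arriving at \<open>\<alpha>\<close> depend on \<open>c\<close> monotonically in opposite directions at \<open>\<gamma>\<close>,
  so the intermediate value theorem yields a speed for which they meet. They cannot meet at 0, since
  touching 0 at \<open>\<gamma>\<close> forces \<open>c < f' \<gamma>\<close> from the left and \<open>c > f' \<gamma>\<close> from the right.
\<close>
lemma matching_speed:
  assumes lt: "\<gamma> < \<alpha>" and dg: "0 < dg" "(g has_real_derivative dg) (at \<gamma>)"
    and S: "0 < S" and qS: "\<And>x. x \<in> {0<..<\<gamma>} \<Longrightarrow> - q x \<le> S * (\<gamma> - x)"
  shows "\<exists>c y w. f' \<gamma> - 2 * sqrt S \<le> c \<and>
    positive_sol (\<lambda>t. c - f' t) (\<lambda>t. - q t) 0 \<gamma> y \<and> y 0 = 0 \<and>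
    positive_sol (\<lambda>t. f' (- t) - c) (\<lambda>t. q (- t)) (- \<alpha>) (- \<gamma>) w \<and> w (- \<alpha>) = 0 \<and>
    w (- \<gamma>) = y \<gamma> \<and> 0 < y \<gamma>"
proof -
  have ql: "0 < - q t" if "t \<in> {0<..<\<gamma>}" for t using q_neg_left[of t] that lt by auto
  have qr: "0 < q (- t)" if "t \<in> {- \<alpha><..<- \<gamma>}" for t using q_pos_middle[of "- t"] that by auto
  have "\<exists>Y B. (\<forall>c. positive_sol (\<lambda>t. - f' t + c) (\<lambda>t. - q t) 0 \<gamma> (Y c) \<and> Y c 0 = 0) \<and>
    (\<forall>c1 c2. c1 \<le> c2 \<longrightarrow> Y c1 \<gamma> \<le> Y c2 \<gamma> \<and> Y c2 \<gamma> \<le> Y c1 \<gamma> + (c2 - c1) * (\<gamma> - 0)) \<and>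
    (\<forall>c. (c - B) * (\<gamma> - 0) \<le> Y c \<gamma>)"
  proof (rule positive_sol_family)
    show "0 \<le> - q t" if "t \<in> {0..\<gamma>}" for t
      using ql[of t] that q_zero by (cases "t = 0 \<or> t = \<gamma>") auto
  qed (use ql \<gamma> in \<open>auto intro!: continuous_intros cont_subset cont_f' cont_q\<close>)
  then obtain Y B where Y': "\<forall>c. positive_sol (\<lambda>t. - f' t + c) (\<lambda>t. - q t) 0 \<gamma> (Y c) \<and> Y c 0 = 0"
    "\<forall>c1 c2. c1 \<le> c2 \<longrightarrow> Y c1 \<gamma> \<le> Y c2 \<gamma> \<and> Y c2 \<gamma> \<le> Y c1 \<gamma> + (c2 - c1) * (\<gamma> - 0)"
    "\<forall>c. (c - B) * (\<gamma> - 0) \<le> Y c \<gamma>"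
    by blast
  then have Y: "\<And>c. positive_sol (\<lambda>t. - f' t + c) (\<lambda>t. - q t) 0 \<gamma> (Y c)" "\<And>c. Y c 0 = 0"
    and Ymono: "\<And>c1 c2. c1 \<le> c2 \<Longrightarrow> Y c1 \<gamma> \<le> Y c2 \<gamma>"
    and Ylip: "\<And>c1 c2. c1 \<le> c2 \<Longrightarrow> Y c2 \<gamma> \<le> Y c1 \<gamma> + (c2 - c1) * \<gamma>"
    and Ygrow: "\<And>c. (c - B) * \<gamma> \<le> Y c \<gamma>"
    by auto
  have "\<exists>Y B. (\<forall>c. positive_sol (\<lambda>t. f' (- t) + c) (\<lambda>t. q (- t)) (- \<alpha>) (- \<gamma>) (Y c) \<and> Y c (- \<alpha>) = 0) \<and>
    (\<forall>c1 c2. c1 \<le> c2 \<longrightarrow> Y c1 (- \<gamma>) \<le> Y c2 (- \<gamma>) \<and> Y c2 (- \<gamma>) \<le> Y c1 (- \<gamma>) + (c2 - c1) * (- \<gamma> - - \<alpha>)) \<and>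
    (\<forall>c. (c - B) * (- \<gamma> - - \<alpha>) \<le> Y c (- \<gamma>))"
  proof (rule positive_sol_family)
    show "0 \<le> q (- t)" if "t \<in> {- \<alpha>..- \<gamma>}" for t
      using qr[of t] that q_zero q_\<alpha> by (cases "t = - \<alpha> \<or> t = - \<gamma>") auto
  qed (use qr \<alpha> \<gamma> lt in \<open>auto intro!: cont_reflect[OF cont_f'] cont_reflect[OF cont_q]\<close>)
  then obtain W B' where W: "\<And>c. positive_sol (\<lambda>t. f' (- t) + c) (\<lambda>t. q (- t)) (- \<alpha>) (- \<gamma>) (W c)"
      "\<And>c. W c (- \<alpha>) = 0"
    and Wmono: "\<And>c1 c2. c1 \<le> c2 \<Longrightarrow> W c1 (- \<gamma>) \<le> W c2 (- \<gamma>)"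
    and Wlip: "\<And>c1 c2. c1 \<le> c2 \<Longrightarrow> W c2 (- \<gamma>) \<le> W c1 (- \<gamma>) + (c2 - c1) * (\<alpha> - \<gamma>)"
    by auto
  have swap: "(\<lambda>t. - f' t + c) = (\<lambda>t. c - f' t)" "(\<lambda>t. f' (- t) + - c) = (\<lambda>t. f' (- t) - c)" for c
    by auto
  \<comment> \<open>The left family is shifted by +c and the reflected one by -c, so raising the
    speed raises Y and lowers W at \<gamma>, and h is nondecreasing in c.\<close>
  define h where "h c = Y c \<gamma> - W (- c) (- \<gamma>)" for c
  have Y0: "0 \<le> Y c \<gamma>" for c using positive_sol_end_nonneg[OF Y(1)] \<gamma> by simp
  have W0: "0 \<le> W c (- \<gamma>)" for c using positive_sol_end_nonneg[OF W(1)] lt by simp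
  \<comment> \<open>At this speed the solution from 0 lands on 0 at \<gamma>, so h is nonpositive.
    Starting the bracket here also yields the lower bound on the matching speed.\<close>
  define c0 where "c0 = f' \<gamma> - 2 * sqrt S"
  \<comment> \<open>Large enough that linear growth of Y at \<gamma> beats the value of W at speed
    \<open>c0\<close>; W at speed \<open>c1\<close> is no larger.\<close>
  define c1 where "c1 = max c0 (B + W (- c0) (- \<gamma>) / \<gamma>)"
  have "Y c0 \<gamma> = 0"
    by (rule leftmost_piece_landing[OF _ _ _ S qS _ Y(1)[of c0, unfolded swap] Y(2)])
      (use \<gamma> lt in \<open>auto simp: c0_def\<close>)
  then have h0: "h c0 \<le> 0" using W0 by (simp add: h_def)
  have "W (- c0) (- \<gamma>) / \<gamma> * \<gamma> \<le> (c1 - B) * \<gamma>" using \<gamma> by (intro mult_right_mono) (auto simp: c1_def)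
  then have h1: "0 \<le> h c1"
    using Ygrow[of c1] Wmono[of "- c1" "- c0"] \<gamma> by (simp add: h_def c1_def)
  \<comment> \<open>The Lipschitz constants are the lengths of the two intervals, and \<gamma> +
    (\<alpha> - \<gamma>) = \<alpha>.\<close>
  have hlip: "\<bar>h c2 - h c1\<bar> \<le> (c2 - c1) * \<alpha>" if "c1 \<le> c2" for c1 c2
    using Ymono[OF that] Ylip[OF that] Wmono[of "- c2" "- c1"] Wlip[of "- c2" "- c1"] that
    by (simp add: h_def abs_le_iff algebra_simps)
  have "continuous_on {c0..c1} h"
    unfolding continuous_on_iff
  proof (intro ballI allI impI)
    fix c \<epsilon> :: real assume "0 < \<epsilon>"
    show "\<exists>d>0. \<forall>c'\<in>{c0..c1}. dist c' c < d \<longrightarrow> dist (h c') (h c) < \<epsilon>"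
    proof (intro exI[of _ "\<epsilon> / \<alpha>"] conjI ballI impI)
      fix c' assume c': "dist c' c < \<epsilon> / \<alpha>"
      have "\<bar>h c' - h c\<bar> \<le> \<bar>c' - c\<bar> * \<alpha>"
        using hlip[of c c'] hlip[of c' c] by (cases "c \<le> c'") (auto simp: abs_minus_commute)
      also have "\<dots> < \<epsilon>" using c' \<alpha> by (simp add: dist_real_def pos_less_divide_eq)
      finally show "dist (h c') (h c) < \<epsilon>" by (simp add: dist_real_def)
    qed (use \<open>0 < \<epsilon>\<close> \<alpha> in simp)
  qed
  then obtain c where c: "c0 \<le> c" "h c = 0"
    using IVT'[of h c0 0 c1] h0 h1 by (auto simp: c1_def)
  have "Y c \<gamma> \<noteq> 0"
  proof
    assume touch: "Y c \<gamma> = 0"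
    \<comment> \<open>Half the derivative of q at \<gamma>, which is \<open>D \<gamma> * dg\<close>
      because g vanishes there. It serves as a linear lower bound for the sources on both
      sides.\<close>
    define m where "m = D \<gamma> * dg / 2"
    have m: "0 < m" using D_pos[of \<gamma>] lt \<gamma> dg by (simp add: m_def)
    have "(q has_real_derivative D' \<gamma> * g \<gamma> + dg * D \<gamma>) (at \<gamma>)"
      unfolding q_def[abs_def] by (rule DERIV_mult) (use deriv_D \<gamma> dg in auto)
    then have "((\<lambda>x. q x / (x - \<gamma>)) \<longlongrightarrow> D \<gamma> * dg) (at \<gamma>)"
      by (simp add: has_field_derivative_iff q_zero g_zero mult.commute)
    then have "eventually (\<lambda>x. m < q x / (x - \<gamma>)) (at \<gamma>)"
      by (rule order_tendstoD(1)) (use m in \<open>simp add: m_def mult.commute\<close>)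
    then obtain d where d: "0 < d" "\<And>x. x \<noteq> \<gamma> \<Longrightarrow> dist x \<gamma> < d \<Longrightarrow> m < q x / (x - \<gamma>)"
      unfolding eventually_at by blast
    have "\<not> 0 \<le> - f' \<gamma> + c"
    proof
      assume "0 \<le> - f' \<gamma> + c"
      then have "Y c \<gamma> \<noteq> 0"
      proof (rule positive_sol_no_touch[OF Y(1) \<gamma>(1) _ _ m d(1), rotated])
        fix t assume t: "t \<in> {0<..<\<gamma>}" "\<gamma> - d < t"
        then have "m < - q t / (\<gamma> - t)" using d(2)[of t] by (simp add: dist_real_def field_simps)
        then show "m * (\<gamma> - t) \<le> - q t" using t by (simp only: pos_less_divide_eq greaterThanLessThan_iff diff_gt_0_iff_gt less_imp_le)
      qed (use \<gamma> in \<open>auto intro!: continuous_intros cont_subset cont_f'\<close>)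
      then show False using touch by simp
    qed
    moreover have "\<not> 0 \<le> f' (- (- \<gamma>)) + - c"
    proof
      assume "0 \<le> f' (- (- \<gamma>)) + - c"
      then have "W (- c) (- \<gamma>) \<noteq> 0"
      proof (rule positive_sol_no_touch[OF W(1) _ _ _ m d(1), rotated 2])
        fix t assume t: "t \<in> {- \<alpha><..<- \<gamma>}" "- \<gamma> - d < t"
        then have "m < q (- t) / (- \<gamma> - t)" using d(2)[of "- t"] by (simp add: dist_real_def minus_diff_commute)
        then have "m * (- \<gamma> - t) < q (- t)" using t by (simp add: pos_less_divide_eq)
        then show "m * (- \<gamma> - t) \<le> q (- t)" by simp
      qed (use \<gamma> \<alpha> lt in \<open>auto intro!: continuous_intros cont_reflect[OF cont_f']\<close>)
      then show False using touch c by (simp add: h_def)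
    qed
    ultimately show False by simp
  qed
  then have "0 < Y c \<gamma>" using Y0[of c] by simp
  then show ?thesis
    using c Y[of c] W[of "- c"] unfolding swap c0_def h_def
    by (intro exI[of _ c] exI[of _ "Y c"] exI[of _ "W (- c)"]) auto
qed

text \<open>The speed is imposed by matching at \<gamma> and cannot be adjusted for the arrival at
  1. It is known to be at least \<open>f' \<gamma> - 2 * sqrt S2\<close>, and the gap condition says
  that this already exceeds or equals the threshold on [\<alpha>, 1].\<close>

lemma wavefront_case_a:
  assumes lt: "\<gamma> < \<alpha>" and dg: "0 < dg" "(g has_real_derivative dg) (at \<gamma>)"
    and b1: "bdd_above ((\<lambda>\<phi>. dq (\<lambda>x. D x * g x) 1 \<phi>) ` {\<alpha>..<1})"
    and b2: "bdd_above ((\<lambda>\<phi>. dq (\<lambda>x. D x * g x) \<gamma> \<phi>) ` {0..<\<gamma>})"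
    and gap: "f' \<gamma> - (f 1 - f \<alpha>) / (1 - \<alpha>) \<ge>
            2 * (sqrt (Sup ((\<lambda>\<phi>. dq (\<lambda>x. D x * g x) 1 \<phi>) ` {\<alpha>..<1}))
               + sqrt (Sup ((\<lambda>\<phi>. dq (\<lambda>x. D x * g x) \<gamma> \<phi>) ` {0..<\<gamma>})))"
  shows "\<exists>c \<phi>. wavefront f D g c \<phi>"
proof -
  define S1 where "S1 = Sup ((\<lambda>\<phi>. dq (\<lambda>x. D x * g x) 1 \<phi>) ` {\<alpha>..<1})"
  define S2 where "S2 = Sup ((\<lambda>\<phi>. dq (\<lambda>x. D x * g x) \<gamma> \<phi>) ` {0..<\<gamma>})"
  have q1: "- q x \<le> S1 * (1 - x)" if "x \<in> {\<alpha><..<1}" for x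
    unfolding S1_def by (rule dq_Sup_bound(1)[OF b1]) (use that q_zero in auto)
  have q2: "- q x \<le> S2 * (\<gamma> - x)" if "x \<in> {0<..<\<gamma>}" for x
    unfolding S2_def by (rule dq_Sup_bound(1)[OF b2]) (use that q_zero in auto)
  have "0 < S1 * (1 - (\<alpha> + 1) / 2)"
    by (rule less_le_trans[OF _ q1]) (use q_neg_right[of "(\<alpha> + 1) / 2"] \<alpha> lt in auto)
  then have S1: "0 < S1" by (rule zero_less_mult_pos2) (use \<alpha> in simp)
  have "0 < S2 * (\<gamma> - \<gamma> / 2)"
    by (rule less_le_trans[OF _ q2]) (use q_neg_left[of "\<gamma> / 2"] \<gamma> lt in auto)
  then have S2: "0 < S2" by (rule zero_less_mult_pos2) (use \<gamma> in simp)
  obtain c y1 y2 where c0: "f' \<gamma> - 2 * sqrt S2 \<le> c"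
    and y1: "positive_sol (\<lambda>t. c - f' t) (\<lambda>t. - q t) 0 \<gamma> y1" "y1 0 = 0" "0 < y1 \<gamma>"
    and y2: "positive_sol (\<lambda>t. f' (- t) - c) (\<lambda>t. q (- t)) (- \<alpha>) (- \<gamma>) y2" "y2 (- \<alpha>) = 0"
      "y2 (- \<gamma>) = y1 \<gamma>"
    using matching_speed[OF lt dg S2 q2] by blast
  have c: "(f 1 - f \<alpha>) / (1 - \<alpha>) + 2 * sqrt S1 \<le> c" using gap c0 unfolding S1_def S2_def by simp
  obtain y3 where y3: "positive_sol (\<lambda>t. f' t - c) (\<lambda>t. - q t) \<alpha> 1 y3" "y3 \<alpha> = 0" "y3 1 = 0"
    using rightmost_piece[OF _ _ _ S1 q1 c, of 0] lt \<alpha> S1 by auto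
  have cy: "continuous_on {0..\<gamma>} y1" "continuous_on {- \<alpha>..- \<gamma>} y2" "continuous_on {\<alpha>..1} y3"
    using y1 y2 y3 by (auto simp: positive_sol_def)
  have py: "x \<in> {0<..<\<gamma>} \<Longrightarrow> 0 < y1 x" "- x \<in> {- \<alpha><..<- \<gamma>} \<Longrightarrow> 0 < y2 (- x)" "x \<in> {\<alpha><..<1} \<Longrightarrow> 0 < y3 x" for x
    using y1 y2 y3 unfolding positive_sol_def by blast+
  define z where "z x = (if x \<le> \<gamma> then - y1 x else if x \<le> \<alpha> then - y2 (- x) else y3 x)" for x
  have "\<exists>\<phi>. wavefront f D g c \<phi>"
  proof (rule wavefront_of_bounded_flux)
    show "g \<alpha> \<noteq> 0" using g_pos[of \<alpha>] \<alpha> lt by simp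
    have "continuous_on {\<gamma>..\<alpha>} (\<lambda>x. - y2 (- x))"
      by (intro continuous_on_minus continuous_on_compose2[OF cy(2)]) (auto intro!: continuous_intros)
    then have rest: "continuous_on {\<gamma>..1} (\<lambda>x. if x \<le> \<alpha> then - y2 (- x) else y3 x)"
      by (rule continuous_on_glue) (use cy y2 y3 in auto)
    show "continuous_on {0..1} z"
      unfolding z_def using cy y1 y2 lt
      by (intro continuous_on_glue[OF _ rest]) (auto intro!: continuous_intros)
    show "z 0 = 0" "z \<alpha> = 0" "z 1 = 0" using y1 y2 y3 \<alpha> \<gamma> lt by (auto simp: z_def)
    show "z x < 0" if "x \<in> {0<..<\<alpha>}" for x
      using py(1,2)[of x] that y1(3) by (cases x \<gamma> rule: linorder_cases) (auto simp: z_def)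
    show "0 < z x" if "x \<in> {\<alpha><..<1}" for x using py(3)[of x] that lt by (simp add: z_def)
    fix x assume x: "x \<in> {0<..<1} - {\<alpha>, \<gamma>}"
    consider "x \<in> {0<..<\<gamma>}" | "x \<in> {\<gamma><..<\<alpha>}" | "x \<in> {\<alpha><..<1}" using x by fastforce
    then show "(z has_real_derivative f' x - c - q x / z x) (at x)"
    proof cases
      case 1
      have "((\<lambda>t. - y1 t) has_real_derivative f' x - c - q x / z x) (at x)"
        using positive_sol_minus_deriv[OF y1(1) 1] 1 by (simp add: z_def)
      then show ?thesis
        by (rule has_field_derivative_transform_within_open[where S = "{0<..<\<gamma>}"]) (use 1 in \<open>auto simp: z_def\<close>)
    next
      case 2
      have "((\<lambda>t. - y2 (- t)) has_real_derivative f' x - c - q x / z x) (at x)"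
        using DERIV_minus[OF positive_sol_reflect_deriv[OF y2(1), of x]] 2 by (simp add: z_def algebra_simps)
      then show ?thesis
        by (rule has_field_derivative_transform_within_open[where S = "{\<gamma><..<\<alpha>}"]) (use 2 in \<open>auto simp: z_def\<close>)
    next
      case 3
      have "(y3 has_real_derivative f' x - c - q x / z x) (at x)"
        using y3(1) 3 lt by (auto simp: z_def positive_sol_def)
      then show ?thesis
        by (rule has_field_derivative_transform_within_open[where S = "{\<alpha><..<1}"]) (use 3 lt in \<open>auto simp: z_def\<close>)
    qed
  qed
  then show ?thesis by blast
qed

end

theorem theorem2p5:
  fixes f D g f' D' :: "real \<Rightarrow> real" and \<alpha> \<gamma> :: real
  assumes "0 < \<alpha>" "\<alpha> < 1" "0 < \<gamma>" "\<gamma> < 1"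
    and "C1_on_01 f f'" "f 0 = 0"
    and "C1_on_01 D D'"
    and "\<forall>x\<in>{0<..<\<alpha>}. D x > 0" "\<forall>x\<in>{\<alpha><..<1}. D x < 0"
    and "continuous_on {0..1} g"
    and "\<forall>x\<in>{0<..<\<gamma>}. g x < 0" "\<forall>x\<in>{\<gamma><..<1}. g x > 0"
    and "g 0 = 0" "g \<gamma> = 0" "g 1 = 0"
    and "strictly_concave_on {0..1} f"
    and cases:
      "(\<alpha> > \<gamma> \<and> (\<exists>dg>0. (g has_real_derivative dg) (at \<gamma>)) \<and>
          bdd_above ((\<lambda>\<phi>. dq (\<lambda>x. D x * g x) 1 \<phi>) ` {\<alpha>..<1}) \<and>
          bdd_above ((\<lambda>\<phi>. dq (\<lambda>x. D x * g x) \<gamma> \<phi>) ` {0..<\<gamma>}) \<and>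
          f' \<gamma> - (f 1 - f \<alpha>) / (1 - \<alpha>) \<ge>
            2 * (sqrt (Sup ((\<lambda>\<phi>. dq (\<lambda>x. D x * g x) 1 \<phi>) ` {\<alpha>..<1}))
               + sqrt (Sup ((\<lambda>\<phi>. dq (\<lambda>x. D x * g x) \<gamma> \<phi>) ` {0..<\<gamma>}))))
     \<or> (\<alpha> = \<gamma> \<and>
          bdd_above ((\<lambda>\<phi>. dq (\<lambda>x. D x * g x) 1 \<phi>) ` {\<alpha>..<1}) \<and>
          bdd_above ((\<lambda>\<phi>. dq (\<lambda>x. D x * g x) \<gamma> \<phi>) ` {0..<\<gamma>}) \<and>
          f' \<gamma> - (f 1 - f \<alpha>) / (1 - \<alpha>) \<ge>
            2 * (sqrt (Sup ((\<lambda>\<phi>. dq (\<lambda>x. D x * g x) 1 \<phi>) ` {\<alpha>..<1}))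
               + sqrt (Sup ((\<lambda>\<phi>. dq (\<lambda>x. D x * g x) \<gamma> \<phi>) ` {0..<\<gamma>}))) \<and>
          (\<exists>L>0. \<exists>\<tau>. 0 < \<tau> \<and> \<tau> < 1 \<and> (\<exists>\<epsilon>>0. \<forall>\<phi>. \<bar>\<phi> - \<gamma>\<bar> < \<epsilon> \<longrightarrow>
              \<bar>g \<phi>\<bar> \<ge> L * \<bar>\<phi> - \<gamma>\<bar> powr \<tau>)))
     \<or> (\<alpha> < \<gamma> \<and>
          bdd_above ((\<lambda>\<phi>. dq (\<lambda>x. D x * g x) 1 \<phi>) ` {\<gamma>..<1}) \<and>
          bdd_above ((\<lambda>\<phi>. dq (\<lambda>x. D x * g x) \<alpha> \<phi>) ` ({0..\<gamma>} - {\<alpha>})) \<and>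
          f' \<gamma> - (f 1 - f \<gamma>) / (1 - \<gamma>) >
            2 * (sqrt (Sup ((\<lambda>\<phi>. dq (\<lambda>x. D x * g x) 1 \<phi>) ` {\<gamma>..<1}))
               + sqrt (Sup ((\<lambda>\<phi>. dq (\<lambda>x. D x * g x) \<alpha> \<phi>) ` ({0..\<gamma>} - {\<alpha>})))))"
  shows "\<exists>c \<phi>. wavefront f D g c \<phi>"
proof -
  interpret degenerate_rde f D g f' D' \<alpha> \<gamma>
    by unfold_locales (use assms(1-16) in auto)
  show ?thesis
    using cases
  proof (elim disjE conjE exE, goal_cases)
    case (1 dg)
    then show ?case by (intro wavefront_case_a)
  next
    case (2 L \<tau> \<epsilon>)
    then show ?case by (intro wavefront_case_b[of L \<tau> \<epsilon>]) auto
  next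
    case 3
    then show ?case by (intro wavefront_case_c less_imp_le)
  qed
qed

end
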